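(* Let $\Lambda\subset M$ and $\Lambda_t\subset M_t$, $t=0,\dots,T$, be weakly compact and convex. There exists $\lambda\in\Lambda$ with $\lambda_t\in\Lambda_t$ for all $t=0,\dots,T$ if and only if \[ \sum_{t=0}^T\sigma_{\Lambda_t}(x_t)+\sigma_\Lambda\Big(-\sum_{t=0}^Tx_t\Big)\ge0\qquad\forall x\in\prod_{t=0}^TC_t . \]
   Context: $S_0,\dots,S_T$ are Polish spaces, $S=S_0\times\cdots\times S_T$, and $d\ge1$ is an integer. For each $t$, $\psi_t:S_t\to[1,\infty)$ is a given continuous function and $\psi(s):=\sum_{t=0}^T\psi_t(s_t)$. The spaces \[ C_t:=\{x_t\in C(S_t;\mathbb R^d)\mid x_t/\psi_t\in C_b(S_t;\mathbb R^d)\},\qquad C:=\{u\in C(S;\mathbb R^d)\mid u/\psi\in C_b(S;\mathbb R^d)\} \] are Banach spaces under the norms $\|x_t/\psi_t\|_{C_b}$ and $\|u/\psi\|_{C_b}$. $M_t$ (resp. $M$) is the space of finite $\mathbb R^d$-valued Borel measures on $S_t$ (resp. $S$) under which $\psi_t$ (resp. $\psi$) is integrable, identified with a subspace of the dual $C_t^*$ (resp. $C^*$) through integration, $\langle u,\lambda\rangle=\sum_{i=1}^d\int u^i\,d\lambda^i$. "Weakly" refers to the topologies induced by the weak*-topologies of $C_t^*$ and $C^*$, i.e. $\sigma(M_t,C_t)$ and $\sigma(M,C)$. $\lambda_t$ is the $t$-th marginal of $\lambda$. In $\sum_tx_t$, the function $x_t$ is identified with $s\mapsto x_t(s_t)$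 on $S$. The support functions are $\sigma_{\Lambda_t}(x_t)=\sup_{\theta\in\Lambda_t}\langle x_t,\theta\rangle$ and $\sigma_\Lambda(u)=\sup_{\lambda\in\Lambda}\langle u,\lambda\rangle$. *)

theory Defs
  imports "HOL-Analysis.Analysis"
begin

definition polish_topology :: "'a topology \<Rightarrow> bool" where
  "polish_topology X \<longleftrightarrow> completely_metrizable_space X \<and> separable_space X"

definition borel_of :: "'a topology \<Rightarrow> 'a measure" where
  "borel_of X = sigma (topspace X) {U. openin X U}"

(* Finite vector measures are countably additive set functions with values in R^d.  They are
   set to 0 off the Borel sets, so that equality of set functions is equality of measures. *)
definition vector_measures :: "'a topology \<Rightarrow> ('a set \<Rightarrow> real ^ 'd) set" where
  "vector_measures X = {\<nu>.
     (\<forall>A. A \<notin> sets (borel_of X) \<longrightarrow> \<nu> A = 0) \<and>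
     (\<forall>A :: nat \<Rightarrow> 'a set. range A \<subseteq> sets (borel_of X) \<longrightarrow> disjoint_family A \<longrightarrow>
        (\<lambda>n. \<nu> (A n)) sums \<nu> (\<Union>n. A n))}"

(* Upper variation mu+(A) = sup {mu(B) | B Borel, B <= A} of a signed measure.  The choice
   B = {} makes the truncation of negative values by ennreal harmless.  The upper variation
   of -mu is the lower variation of mu, and mu = mu+ - mu- is the Jordan decomposition. *)
definition upper_variation :: "'a topology \<Rightarrow> ('a set \<Rightarrow> real) \<Rightarrow> 'a measure" where
  "upper_variation X \<mu> = measure_of (topspace X) (sets (borel_of X))
     (\<lambda>A. SUP B\<in>{B \<in> sets (borel_of X). B \<subseteq> A}. ennreal (\<mu> B))"

definition signed_integrable :: "'a topology \<Rightarrow> ('a set \<Rightarrow> real) \<Rightarrow> ('a \<Rightarrow> real) \<Rightarrow> bool" where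
  "signed_integrable X \<mu> f \<longleftrightarrow>
     integrable (upper_variation X \<mu>) f \<and> integrable (upper_variation X (\<lambda>A. - \<mu> A)) f"

definition signed_integral :: "'a topology \<Rightarrow> ('a set \<Rightarrow> real) \<Rightarrow> ('a \<Rightarrow> real) \<Rightarrow> real" where
  "signed_integral X \<mu> f =
     integral\<^sup>L (upper_variation X \<mu>) f - integral\<^sup>L (upper_variation X (\<lambda>A. - \<mu> A)) f"

(* The spaces C_t and C.  Values of a function outside topspace X are irrelevant. *)
definition weighted_C :: "'a topology \<Rightarrow> ('a \<Rightarrow> real) \<Rightarrow> ('a \<Rightarrow> real ^ 'd) set" where
  "weighted_C X \<psi> =
     {u. continuous_map X euclidean u \<and> bounded ((\<lambda>s. u s /\<^sub>R \<psi> s) ` topspace X)}"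

(* The spaces M_t and M. *)
definition weighted_M :: "'a topology \<Rightarrow> ('a \<Rightarrow> real) \<Rightarrow> ('a set \<Rightarrow> real ^ 'd) set" where
  "weighted_M X \<psi> =
     {\<nu> \<in> vector_measures X. \<forall>i. signed_integrable X (\<lambda>A. \<nu> A $ i) \<psi>}"

definition pairing :: "'a topology \<Rightarrow> ('a \<Rightarrow> real ^ 'd) \<Rightarrow> ('a set \<Rightarrow> real ^ 'd) \<Rightarrow> real" where
  "pairing X u \<nu> = (\<Sum>i\<in>UNIV. signed_integral X (\<lambda>A. \<nu> A $ i) (\<lambda>s. u s $ i))"

(* sigma(M, C): the coarsest topology on M making pairing X u continuous for every u in C. *)
definition weak_topology :: "'a topology \<Rightarrow> ('a \<Rightarrow> real) \<Rightarrow> ('a set \<Rightarrow> real ^ 'd) topology" where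
  "weak_topology X \<psi> =
     pullback_topology (weighted_M X \<psi>)
       (\<lambda>\<nu>. restrict (\<lambda>u. pairing X u \<nu>) (weighted_C X \<psi>))
       (product_topology (\<lambda>_. euclideanreal) (weighted_C X \<psi>))"

(* Set functions carry no real_vector instance, so the library's convex is not available. *)
definition convex_measures :: "('a set \<Rightarrow> real ^ 'd) set \<Rightarrow> bool" where
  "convex_measures \<Lambda> \<longleftrightarrow>
     (\<forall>\<nu>\<in>\<Lambda>. \<forall>\<mu>\<in>\<Lambda>. \<forall>a\<ge>0. \<forall>b\<ge>0. a + b = 1 \<longrightarrow> (\<lambda>A. a *\<^sub>R \<nu> A + b *\<^sub>R \<mu> A) \<in> \<Lambda>)"

(* Extended-real valued; it is -\<infinity> on the empty set. *)
definition support_fun ::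
    "'a topology \<Rightarrow> ('a set \<Rightarrow> real ^ 'd) set \<Rightarrow> ('a \<Rightarrow> real ^ 'd) \<Rightarrow> ereal" where
  "support_fun X \<Lambda> u = (SUP \<nu>\<in>\<Lambda>. ereal (pairing X u \<nu>))"

(* S_0 x ... x S_T, realised as extensional functions on {..T}. *)
definition path_space :: "(nat \<Rightarrow> 'a topology) \<Rightarrow> nat \<Rightarrow> (nat \<Rightarrow> 'a) topology" where
  "path_space S T = product_topology S {..T}"

definition sum_weight :: "(nat \<Rightarrow> 'a \<Rightarrow> real) \<Rightarrow> nat \<Rightarrow> (nat \<Rightarrow> 'a) \<Rightarrow> real" where
  "sum_weight \<psi> T s = (\<Sum>t\<le>T. \<psi> t (s t))"

definition marginal ::
    "(nat \<Rightarrow> 'a topology) \<Rightarrow> nat \<Rightarrow> nat \<Rightarrow> ((nat \<Rightarrow> 'a) set \<Rightarrow> real ^ 'd) \<Rightarrow> 'a set \<Rightarrow> real ^ 'd" where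
  "marginal S T t \<nu> A =
     (if A \<in> sets (borel_of (S t)) then \<nu> {s \<in> topspace (path_space S T). s t \<in> A} else 0)"

end

theory Submission
  imports Defs
begin

text \<open>
  If \<open>\<nu> \<in> \<Lambda>\<close> has all its marginals in the sets \<open>\<Lambda>t t\<close>, then for each \<open>x\<close> the pairings of
  \<open>x t\<close> with the marginals and of \<open>- (\<Sum>t. x t)\<close> with \<open>\<nu>\<close> add up to 0, by the image measure
  formula (\<open>pairing_marginal\<close>); the support functions dominate these pairings.

  Conversely, consider the pairs \<open>(\<nu>, \<theta>)\<close> in the product of \<open>\<Lambda>\<close> and all \<open>\<Lambda>t t\<close>, which is compact
  for the product of the weak topologies, and for each \<open>x\<close> the functional
  \<open>gap x (\<nu>, \<theta>) = (\<Sum>t. \<langle>x t, \<theta> t\<rangle>) + \<langle>- (\<Sum>t. x t), \<nu>\<rangle>\<close>. It is continuous, affine in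
  \<open>(\<nu>, \<theta>)\<close> and linear in \<open>x\<close>, and its supremum over the product is the sum of support
  functions in the criterion, which for \<open>x = 0\<close> rules out that one of the sets is empty. Since suprema are attained, the criterion says that every \<open>gap x\<close> is
  nonnegative somewhere on the product. By \<open>convex_compact_common_zero\<close> some \<open>(\<nu>, \<theta>)\<close> is a zero of all
  the \<open>gap x\<close> at once. This replaces the Hahn-Banach theorem: compactness reduces the claim to
  finitely many \<open>x\<close>, where minimising a sum of squares gives the separating combination. A common
  zero satisfies \<open>\<langle>u, \<theta> t\<rangle> = \<langle>u, marginal t \<nu>\<rangle>\<close> for all \<open>u\<close> in the weighted space. As
  bounded continuous functions determine a finite signed Borel measure on a metrizable space
  (\<open>signed_measure_eqI\<close>), \<open>\<theta> t\<close> is the marginal of \<open>\<nu>\<close>.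

  The measure theory behind the pairing rests on two facts. The upper variation is a measure,
  and the two variations of a signed measure, when finite, form its Jordan decomposition; finiteness
  comes for free from integrability of a weight that is at least 1. Linear relations between finite
  measures pass to integrals (\<open>integral_linear_relation\<close>), which yields linearity of the pairing in
  the measure and the image measure formula.
\<close>

section \<open>Borel sets and continuous maps\<close>

lemma space_borel_of [simp]: "space (borel_of X) = topspace X"
  unfolding borel_of_def by (rule space_measure_of) (auto dest: openin_subset)

lemma sets_borel_of: "sets (borel_of X) = sigma_sets (topspace X) {U. openin X U}"
  unfolding borel_of_def by (rule sets_measure_of) (auto dest: openin_subset)

lemma openin_borel_of: "openin X U \<Longrightarrow> U \<in> sets (borel_of X)"
  unfolding sets_borel_of by auto

lemma closedin_borel_of: "closedin X F \<Longrightarrow> F \<in> sets (borel_of X)"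
  by (metis closedin_def openin_borel_of double_diff order_refl sets.compl_sets space_borel_of)

lemma continuous_map_measurable:
  assumes "continuous_map X Y f"
  shows "f \<in> measurable (borel_of X) (borel_of Y)"
  unfolding borel_of_def[of Y]
proof (rule measurable_sigma_sets)
  show "sets (sigma (topspace Y) {U. openin Y U}) = sigma_sets (topspace Y) {U. openin Y U}"
    using sets_borel_of[of Y] unfolding borel_of_def .
  show "{U. openin Y U} \<subseteq> Pow (topspace Y)" by (auto dest: openin_subset)
  show "f \<in> space (borel_of X) \<rightarrow> topspace Y"
    using assms by (auto simp: continuous_map_def)
  fix U assume "U \<in> {U. openin Y U}"
  then have "openin X {x \<in> topspace X. f x \<in> U}"
    using assms by (auto simp: continuous_map_def)
  then show "f -` U \<inter> space (borel_of X) \<in> sets (borel_of X)"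
    by (auto dest!: openin_borel_of simp: Int_def conj_commute)
qed

lemma continuous_map_borel_measurable:
  assumes "continuous_map X euclidean f"
  shows "f \<in> borel_measurable (borel_of X)"
proof -
  have "borel_of euclidean = (borel :: 'b measure)"
    by (simp add: borel_of_def borel_def)
  then show ?thesis
    using continuous_map_measurable[OF assms] by simp
qed

lemma continuous_map_linear:
  assumes "bounded_linear L" "continuous_map X euclidean f"
  shows "continuous_map X euclidean (\<lambda>x. L (f x))"
proof -
  have "continuous_map euclidean euclidean L"
    unfolding continuous_map_iff_continuous2 by (rule linear_continuous_on[OF assms(1)])
  then show ?thesis
    using continuous_map_compose[OF assms(2), of euclidean L] by (simp add: o_def)
qed

section \<open>Signed measures and their variations\<close>

text \<open>
  Countable additivity of a real set function on the Borel sets. Values off the Borel sets are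
  irrelevant, and infinite values do not occur.
\<close>
definition signed_measure :: "'a topology \<Rightarrow> ('a set \<Rightarrow> real) \<Rightarrow> bool" where
  "signed_measure X \<mu> \<longleftrightarrow>
     (\<forall>A. range A \<subseteq> sets (borel_of X) \<longrightarrow> disjoint_family A \<longrightarrow>
        (\<lambda>n. \<mu> (A n)) sums \<mu> (\<Union>n::nat. A n))"

lemma signed_measureD:
  "signed_measure X \<mu> \<Longrightarrow> (\<And>n. A n \<in> sets (borel_of X)) \<Longrightarrow> disjoint_family A \<Longrightarrow>
     (\<lambda>n. \<mu> (A n)) sums \<mu> (\<Union>n::nat. A n)"
  unfolding signed_measure_def by blast

lemma signed_measure_uminus:
  "signed_measure X \<mu> \<Longrightarrow> signed_measure X (\<lambda>A. - \<mu> A)"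
  unfolding signed_measure_def by (auto intro: sums_minus)

lemma signed_measure_empty:
  assumes "signed_measure X \<mu>"
  shows "\<mu> {} = 0"
proof -
  have "(\<lambda>n::nat. \<mu> {}) sums \<mu> (\<Union>n::nat. {})"
    by (rule signed_measureD[OF assms]) (auto simp: disjoint_family_on_def)
  then show ?thesis
    by (simp add: sums_iff summable_const_iff)
qed

lemma signed_measure_Un:
  assumes "signed_measure X \<mu>" "A \<in> sets (borel_of X)" "B \<in> sets (borel_of X)" "A \<inter> B = {}"
  shows "\<mu> (A \<union> B) = \<mu> A + \<mu> B"
proof -
  have "(\<lambda>n. \<mu> (binaryset A B n)) sums \<mu> (\<Union>n. binaryset A B n)"
    by (rule signed_measureD[OF assms(1)])
       (use assms in \<open>auto simp: binaryset_def disjoint_family_on_def\<close>)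
  moreover have "(\<lambda>n. \<mu> (binaryset A B n)) sums (\<mu> A + \<mu> B)"
    by (rule binaryset_sums) (rule signed_measure_empty[OF assms(1)])
  ultimately show ?thesis
    using sums_unique2 UN_binaryset_eq by metis
qed

lemma signed_measure_Diff:
  assumes "signed_measure X \<mu>" "A \<in> sets (borel_of X)" "B \<in> sets (borel_of X)" "B \<subseteq> A"
  shows "\<mu> (A - B) = \<mu> A - \<mu> B"
  using signed_measure_Un[OF assms(1), of "A - B" B] assms
  by (simp add: Un_absorb2 Int_commute)

lemma sets_upper_variation [simp]: "sets (upper_variation X \<mu>) = sets (borel_of X)"
  unfolding upper_variation_def
  by (metis sets.sets_measure_of_eq space_borel_of)

lemma space_upper_variation [simp]: "space (upper_variation X \<mu>) = topspace X"
  by (metis sets_eq_imp_space_eq sets_upper_variation space_borel_of)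

text \<open>
  One half of the additivity of the upper variation; the other half holds even for countable
  unions, because a subset of a disjoint union splits into its traces.
\<close>
lemma upper_variation_superadditive:
  assumes \<mu>: "signed_measure X \<mu>"
    and A: "A \<in> sets (borel_of X)" and B: "B \<in> sets (borel_of X)" and disj: "A \<inter> B = {}"
  defines "U \<equiv> \<lambda>A. SUP B\<in>{B \<in> sets (borel_of X). B \<subseteq> A}. ennreal (\<mu> B)"
  shows "U A + U B \<le> U (A \<union> B)"
proof -
  have U_eq: "U A = (SUP B\<in>{B \<in> sets (borel_of X). B \<subseteq> A}. ennreal (\<mu> B))" for A
    unfolding U_def ..
  have ne: "{B \<in> sets (borel_of X). B \<subseteq> A} \<noteq> {}" for A by blast
  have le: "ennreal (\<mu> C) + ennreal (\<mu> D) \<le> U (A \<union> B)"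
    if C: "C \<in> sets (borel_of X)" "C \<subseteq> A" and D: "D \<in> sets (borel_of X)" "D \<subseteq> B" for C D
  proof -
    \<comment> \<open>A set of negative measure is replaced by the empty set.\<close>
    define C' where "C' = (if \<mu> C \<ge> 0 then C else {})"
    define D' where "D' = (if \<mu> D \<ge> 0 then D else {})"
    have 1: "C' \<in> sets (borel_of X)" "D' \<in> sets (borel_of X)" "C' \<union> D' \<subseteq> A \<union> B" "C' \<inter> D' = {}"
      using C D disj unfolding C'_def D'_def by auto
    have 2: "ennreal (\<mu> C) = ennreal (\<mu> C')" "ennreal (\<mu> D) = ennreal (\<mu> D')"
            "\<mu> C' \<ge> 0" "\<mu> D' \<ge> 0"
      using signed_measure_empty[OF \<mu>] unfolding C'_def D'_def by (auto simp: ennreal_neg)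
    have "ennreal (\<mu> C) + ennreal (\<mu> D) = ennreal (\<mu> (C' \<union> D'))"
      using 2 by (simp add: signed_measure_Un[OF \<mu> 1(1,2,4)])
    also have "\<dots> \<le> U (A \<union> B)"
      unfolding U_def by (rule SUP_upper) (use 1 in auto)
    finally show ?thesis .
  qed
  have "U A + ennreal (\<mu> D) \<le> U (A \<union> B)" if D: "D \<in> sets (borel_of X)" "D \<subseteq> B" for D
  proof -
    have "U A + ennreal (\<mu> D) = (SUP C\<in>{C \<in> sets (borel_of X). C \<subseteq> A}. ennreal (\<mu> C) + ennreal (\<mu> D))"
      unfolding U_eq[of A] by (rule ennreal_SUP_add_left[OF ne, symmetric])
    also have "\<dots> \<le> U (A \<union> B)"
      by (rule SUP_least) (use D le in auto)
    finally show ?thesis .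
  qed
  then have "(SUP D\<in>{D \<in> sets (borel_of X). D \<subseteq> B}. U A + ennreal (\<mu> D)) \<le> U (A \<union> B)"
    by (intro SUP_least) auto
  then show ?thesis
    unfolding U_eq[of B] ennreal_SUP_add_right[OF ne] .
qed

text \<open>
  The supremum defining the upper variation is countably additive, so that the measure built
  from it takes these suprema as its values. Finiteness plays no role here.
\<close>
lemma emeasure_upper_variation:
  assumes \<mu>: "signed_measure X \<mu>" and A: "A \<in> sets (borel_of X)"
  shows "emeasure (upper_variation X \<mu>) A = (SUP B\<in>{B \<in> sets (borel_of X). B \<subseteq> A}. ennreal (\<mu> B))"
proof -
  define U where "U = (\<lambda>A. SUP B\<in>{B \<in> sets (borel_of X). B \<subseteq> A}. ennreal (\<mu> B))"
  have U_eq: "U A = (SUP B\<in>{B \<in> sets (borel_of X). B \<subseteq> A}. ennreal (\<mu> B))" for A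
    unfolding U_def ..
  have mono: "U A \<le> U B" if "A \<subseteq> B" for A B
    unfolding U_def by (rule SUP_subset_mono) (use that in auto)
  have empty: "U {} = 0"
    unfolding U_def using signed_measure_empty[OF \<mu>] by (intro antisym SUP_least) auto
  have "countably_additive (sets (borel_of X)) U"
  proof (rule countably_additiveI)
    fix A :: "nat \<Rightarrow> 'a set"
    assume A: "range A \<subseteq> sets (borel_of X)" and d: "disjoint_family A"
      and UA: "(\<Union>i. A i) \<in> sets (borel_of X)"
    have max0: "ennreal (max 0 r) = ennreal r" for r :: real
      by (simp add: max_def ennreal_neg)
    have A': "A i \<in> sets (borel_of X)" for i using A by blast
    have le: "(\<Sum>i<n. U (A i)) \<le> U (\<Union>i<n. A i)" for n
    proof (induction n)
      case (Suc n)
      have "(\<Sum>i<Suc n. U (A i)) \<le> U (\<Union>i<n. A i) + U (A n)"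
        unfolding sum.lessThan_Suc by (rule add_right_mono[OF Suc])
      also have "\<dots> \<le> U ((\<Union>i<n. A i) \<union> A n)"
      proof -
        have "A i \<inter> A n = {}" if "i < n" for i
          by (rule disjoint_family_onD[OF d]) (use that in auto)
        then have disj: "(\<Union>i<n. A i) \<inter> A n = {}"
          by blast
        have "(\<Union>i<n. A i) \<in> sets (borel_of X)"
          using A' by (intro sets.finite_UN) simp_all
        from upper_variation_superadditive[OF \<mu> this A' disj] show ?thesis
          unfolding U_def .
      qed
      also have "(\<Union>i<n. A i) \<union> A n = (\<Union>i<Suc n. A i)"
        by (auto simp: less_Suc_eq)
      finally show ?case .
    qed (simp add: empty)
    have "(\<Sum>i. U (A i)) \<le> U (\<Union>i. A i)"
    proof (rule suminf_le_const)
      show "(\<Sum>i<n. U (A i)) \<le> U (\<Union>i. A i)" for n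
        by (rule order_trans[OF le mono]) auto
    qed simp
    moreover have "U (\<Union>i. A i) \<le> (\<Sum>i. U (A i))"
      unfolding U_eq[of "\<Union>i. A i"]
    proof (rule SUP_least)
      fix B assume B: "B \<in> {B \<in> sets (borel_of X). B \<subseteq> (\<Union>i. A i)}"
      have BA: "B \<inter> A i \<in> sets (borel_of X)" for i
        using B A by auto
      have "(\<lambda>n. \<mu> (B \<inter> A n)) sums \<mu> (\<Union>n. B \<inter> A n)"
        by (rule signed_measureD[OF \<mu> BA]) (use d in \<open>auto simp: disjoint_family_on_def\<close>)
      also have "(\<Union>n. B \<inter> A n) = B" using B by auto
      finally have "(\<lambda>n. ennreal (\<Sum>i<n. \<mu> (B \<inter> A i))) \<longlonglongrightarrow> ennreal (\<mu> B)"
        unfolding sums_def by (rule tendsto_ennrealI)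
      moreover have "ennreal (\<Sum>i<n. \<mu> (B \<inter> A i)) \<le> (\<Sum>i. U (A i))" for n
      proof -
        have "ennreal (\<Sum>i<n. \<mu> (B \<inter> A i)) \<le> ennreal (\<Sum>i<n. max 0 (\<mu> (B \<inter> A i)))"
          by (intro ennreal_leI sum_mono) auto
        also have "\<dots> = (\<Sum>i<n. ennreal (\<mu> (B \<inter> A i)))"
          using sum_ennreal[of "{..<n}" "\<lambda>i. max 0 (\<mu> (B \<inter> A i))"] by (simp add: max0)
        also have "\<dots> \<le> (\<Sum>i<n. U (A i))"
          by (intro sum_mono) (auto simp: U_def intro!: SUP_upper BA)
        also have "\<dots> \<le> (\<Sum>i. U (A i))"
          by (rule sum_le_suminf) auto
        finally show ?thesis .
      qed
      ultimately show "ennreal (\<mu> B) \<le> (\<Sum>i. U (A i))"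
        by (meson LIMSEQ_le_const2)
    qed
    ultimately show "(\<Sum>i. U (A i)) = U (\<Union>i. A i)" by (rule antisym)
  qed
  then have "emeasure (measure_of (topspace X) (sets (borel_of X)) U) A = U A"
    using A empty sets.sigma_algebra_axioms[of "borel_of X"]
    by (intro emeasure_measure_of_sigma) (auto simp: positive_def)
  then show ?thesis unfolding upper_variation_def U_def .
qed

lemma upper_variation_le:
  assumes \<mu>: "signed_measure X \<mu>" and M: "sets M = sets (borel_of X)"
    and le: "\<And>A. A \<in> sets (borel_of X) \<Longrightarrow> ennreal (\<mu> A) \<le> emeasure M A"
  shows "upper_variation X \<mu> \<le> M"
proof (rule le_measure[THEN iffD2])
  show "\<forall>A\<in>sets (upper_variation X \<mu>). emeasure (upper_variation X \<mu>) A \<le> emeasure M A"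
  proof
    fix A assume "A \<in> sets (upper_variation X \<mu>)"
    then have A: "A \<in> sets (borel_of X)" by simp
    show "emeasure (upper_variation X \<mu>) A \<le> emeasure M A"
      unfolding emeasure_upper_variation[OF \<mu> A]
    proof (rule SUP_least)
      fix B assume B: "B \<in> {B \<in> sets (borel_of X). B \<subseteq> A}"
      then have "ennreal (\<mu> B) \<le> emeasure M B" by (intro le) simp
      also have "\<dots> \<le> emeasure M A" using A B M by (intro emeasure_mono) auto
      finally show "ennreal (\<mu> B) \<le> emeasure M A" .
    qed
  qed
qed (simp add: M)

lemma integrable_mono_measure:
  fixes f :: "'a \<Rightarrow> real"
  assumes "sets M = sets N" "M \<le> N" "integrable N f"
  shows "integrable M f"
proof (rule integrableI_bounded)
  show "f \<in> borel_measurable M"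
    using assms by (metis borel_measurable_integrable measurable_cong_sets)
  show "(\<integral>\<^sup>+ x. norm (f x) \<partial>M) < \<infinity>"
    using nn_integral_mono_measure[OF assms(1,2)] assms(3)
    by (metis integrable_iff_bounded order_le_less_trans)
qed

text \<open>
  A signed measure whose upper and lower variations are finite. The Hahn decomposition makes the
  finiteness automatic, but every signed measure below satisfies it by a direct bound.
\<close>
definition finite_signed :: "'a topology \<Rightarrow> ('a set \<Rightarrow> real) \<Rightarrow> bool" where
  "finite_signed X \<mu> \<longleftrightarrow> signed_measure X \<mu> \<and> finite_measure (upper_variation X \<mu>)
     \<and> finite_measure (upper_variation X (\<lambda>A. - \<mu> A))"

text \<open>
  Given finiteness, no Hahn set is needed: for \<open>B \<subseteq> A\<close> one has
  \<open>\<mu> B = \<mu> A - \<mu> (A - B)\<close>, so the upper variation of \<open>A\<close> is at most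
  \<open>\<mu> A\<close> plus the lower variation of \<open>A\<close>, and symmetrically.
\<close>
lemma jordan_decomposition:
  assumes fs: "finite_signed X \<mu>" and A: "A \<in> sets (borel_of X)"
  shows "\<mu> A = measure (upper_variation X \<mu>) A - measure (upper_variation X (\<lambda>A. - \<mu> A)) A"
proof -
  have \<mu>: "signed_measure X \<mu>" using fs unfolding finite_signed_def by blast
  have half: "- \<nu> A + measure (upper_variation X \<nu>) A \<le> measure (upper_variation X (\<lambda>A. - \<nu> A)) A"
    if \<nu>: "finite_signed X \<nu>" for \<nu>
  proof -
    have s: "signed_measure X \<nu>" and f: "finite_measure (upper_variation X \<nu>)"
        "finite_measure (upper_variation X (\<lambda>A. - \<nu> A))"
      using \<nu> unfolding finite_signed_def by auto
    note s' = signed_measure_uminus[OF s]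
    let ?m = "measure (upper_variation X (\<lambda>A. - \<nu> A)) A"
    have "ennreal (\<nu> B) \<le> ennreal (\<nu> A + ?m)" if B: "B \<in> sets (borel_of X)" "B \<subseteq> A" for B
    proof -
      have "ennreal (- \<nu> (A - B)) \<le> emeasure (upper_variation X (\<lambda>A. - \<nu> A)) A"
        unfolding emeasure_upper_variation[OF s' A] by (rule SUP_upper) (use A B in auto)
      then have "- \<nu> (A - B) \<le> ?m"
        by (simp add: finite_measure.emeasure_eq_measure[OF f(2)] ennreal_le_iff)
      then show ?thesis
        using signed_measure_Diff[OF s A B] by (intro ennreal_leI) simp
    qed
    then have "emeasure (upper_variation X \<nu>) A \<le> ennreal (\<nu> A + ?m)"
      unfolding emeasure_upper_variation[OF s A] by (intro SUP_least) auto
    moreover have "0 \<le> \<nu> A + ?m"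
    proof -
      have "ennreal (- \<nu> A) \<le> emeasure (upper_variation X (\<lambda>A. - \<nu> A)) A"
        unfolding emeasure_upper_variation[OF s' A] by (rule SUP_upper) (use A in auto)
      then show ?thesis
        by (simp add: finite_measure.emeasure_eq_measure[OF f(2)] ennreal_le_iff)
    qed
    ultimately show ?thesis
      by (simp add: finite_measure.emeasure_eq_measure[OF f(1)] ennreal_le_iff)
  qed
  have "finite_signed X (\<lambda>A. - \<mu> A)"
    using fs signed_measure_uminus unfolding finite_signed_def by auto
  from half[OF this] half[OF fs] show ?thesis by simp
qed

text \<open>
  A linear relation between finite measures passes to the integrals of a common integrable
  function: it holds for simple functions, and dominated convergence does the rest. All linearity
  of integrals in the measure is derived from this lemma, which avoids forming sums of measures.
\<close>
lemma integral_linear_relation: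
  fixes f :: "'a \<Rightarrow> real"
  assumes I: "finite I" and sets: "\<And>i. i \<in> I \<Longrightarrow> sets (M i) = sets N"
    and fin: "\<And>i. i \<in> I \<Longrightarrow> finite_measure (M i)"
    and int: "\<And>i. i \<in> I \<Longrightarrow> integrable (M i) f"
    and rel: "\<And>A. A \<in> sets N \<Longrightarrow> (\<Sum>i\<in>I. c i * measure (M i) A) = 0"
  shows "(\<Sum>i\<in>I. c i * integral\<^sup>L (M i) f) = 0"
proof (cases "I = {}")
  case False
  then obtain i0 where i0: "i0 \<in> I" by blast
  have space: "space (M i) = space N" if "i \<in> I" for i
    using sets[OF that] by (rule sets_eq_imp_space_eq)
  have f: "f \<in> borel_measurable N"
    using int[OF i0] sets[OF i0] by (metis borel_measurable_integrable measurable_cong_sets)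
  obtain F where F: "\<And>k. simple_function N (F k)"
    and lim: "\<And>x. x \<in> space N \<Longrightarrow> (\<lambda>k. F k x) \<longlonglongrightarrow> f x"
    and bd: "\<And>k x. x \<in> space N \<Longrightarrow> dist (F k x) 0 \<le> 2 * dist (f x) 0"
    using borel_measurable_implies_sequence_metric[OF f, of 0] by blast
  have meas: "F k \<in> borel_measurable (M i)" "simple_function (M i) (F k)" if "i \<in> I" for i k
    using F[of k] sets[OF that] space[OF that]
    by (auto simp: borel_measurable_simple_function simple_function_def cong: measurable_cong_sets)
  have zero: "(\<Sum>i\<in>I. c i * integral\<^sup>L (M i) (F k)) = 0" for k
  proof -
    have eq: "integral\<^sup>L (M i) (F k) = (\<Sum>y\<in>F k ` space N. measure (M i) {x \<in> space N. F k x = y} * y)"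
      if i: "i \<in> I" for i
    proof -
      interpret finite_measure "M i" by (rule fin[OF i])
      show ?thesis
        using simple_bochner_integrable_eq_integral[OF simple_bochner_integrable.intros[OF meas(2)[OF i]]]
        by (simp add: simple_bochner_integral_def space[OF i])
    qed
    have "(\<Sum>i\<in>I. c i * integral\<^sup>L (M i) (F k)) =
        (\<Sum>i\<in>I. \<Sum>y\<in>F k ` space N. y * (c i * measure (M i) {x \<in> space N. F k x = y}))"
      by (intro sum.cong refl) (simp add: eq sum_distrib_left mult_ac)
    also have "\<dots> = (\<Sum>y\<in>F k ` space N. y * (\<Sum>i\<in>I. c i * measure (M i) {x \<in> space N. F k x = y}))"
      by (subst sum.swap) (simp add: sum_distrib_left)
    also have "\<dots> = 0"
    proof (intro sum.neutral ballI)
      fix y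
      have "{x \<in> space N. F k x = y} = F k -` {y} \<inter> space N" by auto
      then have "{x \<in> space N. F k x = y} \<in> sets N"
        using simple_functionD(2)[OF F[of k], of "{y}"] by simp
      then show "y * (\<Sum>i\<in>I. c i * measure (M i) {x \<in> space N. F k x = y}) = 0"
        by (simp add: rel)
    qed
    finally show ?thesis .
  qed
  have "(\<lambda>k. integral\<^sup>L (M i) (F k)) \<longlonglongrightarrow> integral\<^sup>L (M i) f" if i: "i \<in> I" for i
    by (rule integral_dominated_convergence[where w="\<lambda>x. 2 * norm (f x)"])
       (use int[OF i] meas(1)[OF i] lim bd space[OF i] in auto)
  then have "(\<lambda>k. \<Sum>i\<in>I. c i * integral\<^sup>L (M i) (F k)) \<longlonglongrightarrow> (\<Sum>i\<in>I. c i * integral\<^sup>L (M i) f)"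
    by (intro tendsto_sum tendsto_mult tendsto_const)
  then show ?thesis
    unfolding zero by (simp add: LIMSEQ_const_iff)
qed simp

text \<open>
  The integral against a signed measure may be computed from any representation as a difference
  of finite measures, not only from the Jordan decomposition.
\<close>
lemma signed_integral_diff_measures:
  fixes f :: "'a \<Rightarrow> real"
  assumes \<mu>: "signed_measure X \<mu>"
    and P: "finite_measure P" "sets P = sets (borel_of X)"
    and N: "finite_measure N" "sets N = sets (borel_of X)"
    and eq: "\<And>A. A \<in> sets (borel_of X) \<Longrightarrow> \<mu> A = measure P A - measure N A"
  shows "finite_signed X \<mu>"
    and "integrable P f \<Longrightarrow> integrable N f \<Longrightarrow>
      signed_integral X \<mu> f = integral\<^sup>L P f - integral\<^sup>L N f"
proof -
  interpret P: finite_measure P by fact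
  interpret N: finite_measure N by fact
  have leP: "upper_variation X \<mu> \<le> P"
    by (rule upper_variation_le[OF \<mu> P(2)])
       (auto simp: eq P.emeasure_eq_measure intro!: ennreal_leI)
  have leN: "upper_variation X (\<lambda>A. - \<mu> A) \<le> N"
    by (rule upper_variation_le[OF signed_measure_uminus[OF \<mu>] N(2)])
       (auto simp: eq N.emeasure_eq_measure intro!: ennreal_leI)
  have fin: "finite_measure M" if "sets M = sets M'" "M \<le> M'" "finite_measure M'" for M M' :: "'a measure"
  proof (rule finite_measureI)
    have "emeasure M (space M) \<le> emeasure M' (space M')"
      using that(2) le_measure[OF that(1)] sets_eq_imp_space_eq[OF that(1)] by (metis sets.top)
    then show "emeasure M (space M) \<noteq> \<infinity>"
      using finite_measure.emeasure_finite[OF that(3)] by (metis infinity_ennreal_def neq_top_trans)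
  qed
  show fs: "finite_signed X \<mu>"
    unfolding finite_signed_def
    using \<mu> fin[OF _ leP P(1)] fin[OF _ leN N(1)] P(2) N(2) by simp
  assume fP: "integrable P f" and fN: "integrable N f"
  have si: "signed_integrable X \<mu> f"
    unfolding signed_integrable_def
    using integrable_mono_measure[OF _ leP fP] integrable_mono_measure[OF _ leN fN] P(2) N(2) by simp
  \<comment> \<open>The four measures satisfy \<open>\<mu>\<^sup>+ - \<mu>\<^sup>- - P + N = 0\<close>.\<close>
  define M where "M = (\<lambda>i::nat. [upper_variation X \<mu>, upper_variation X (\<lambda>A. - \<mu> A), P, N] ! i)"
  define c where "c = (\<lambda>i::nat. [1, -1, -1, 1::real] ! i)"
  have I: "{..<4} = {0, 1, 2, 3::nat}" by auto
  have M: "\<forall>i\<in>{..<4}. sets (M i) = sets (borel_of X) \<and> finite_measure (M i) \<and> integrable (M i) f"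
    using fs si unfolding I M_def finite_signed_def signed_integrable_def
    by (simp add: P N fP fN)
  have "(\<Sum>i<4. c i * measure (M i) A) = 0" if A: "A \<in> sets (borel_of X)" for A
    using jordan_decomposition[OF fs A] eq[OF A] unfolding I c_def M_def by simp
  then have "(\<Sum>i<4. c i * integral\<^sup>L (M i) f) = 0"
    using M by (intro integral_linear_relation[where N = "borel_of X"]) blast+
  then show "signed_integral X \<mu> f = integral\<^sup>L P f - integral\<^sup>L N f"
    unfolding I c_def M_def signed_integral_def by simp
qed

lemma signed_integral_linear_relation:
  assumes I: "finite I" and fs: "\<And>i. i \<in> I \<Longrightarrow> finite_signed X (\<mu> i)"
    and int: "\<And>i. i \<in> I \<Longrightarrow> signed_integrable X (\<mu> i) f"
    and rel: "\<And>A. A \<in> sets (borel_of X) \<Longrightarrow> (\<Sum>i\<in>I. c i * \<mu> i A) = 0"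
  shows "(\<Sum>i\<in>I. c i * signed_integral X (\<mu> i) f) = 0"
proof -
  define M where "M = (\<lambda>(i, b). if b then upper_variation X (\<mu> i) else upper_variation X (\<lambda>A. - \<mu> i A))"
  define d where "d = (\<lambda>(i, b). if b then c i else - c i)"
  have split: "(\<Sum>j\<in>I \<times> UNIV. h j) = (\<Sum>i\<in>I. h (i, True) + h (i, False))" for h :: "_ \<Rightarrow> real"
    using sum.cartesian_product[of "\<lambda>i b. h (i, b)" UNIV I] by (simp add: UNIV_bool add.commute)
  have "(\<Sum>j\<in>I \<times> UNIV. d j * integral\<^sup>L (M j) f) = 0"
  proof (rule integral_linear_relation[where N = "borel_of X"])
    fix A assume A: "A \<in> sets (borel_of X)"
    have "(\<Sum>j\<in>I \<times> UNIV. d j * measure (M j) A) = (\<Sum>i\<in>I. c i * \<mu> i A)"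
      unfolding split
      by (intro sum.cong refl)
         (simp add: d_def M_def jordan_decomposition[OF fs A] right_diff_distrib)
    then show "(\<Sum>j\<in>I \<times> UNIV. d j * measure (M j) A) = 0"
      using rel[OF A] by simp
  qed (use I fs int in \<open>auto simp: M_def finite_signed_def signed_integrable_def split: if_splits\<close>)
  then show ?thesis
    unfolding split by (simp add: d_def M_def signed_integral_def right_diff_distrib)
qed

section \<open>Bounded continuous functions determine a signed measure\<close>

text \<open>
  A closed set is a countable intersection of open sets \<open>U n\<close>; the approximating functions are
  finite products of Urysohn functions that are 1 on the closed set and 0 off \<open>U n\<close>.
\<close>
lemma closed_indicator_limit:
  assumes X: "metrizable_space X" and F: "closedin X F"
  obtains g :: "nat \<Rightarrow> 'a \<Rightarrow> real"
  where "\<And>n. continuous_map X euclideanreal (g n)"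
    and "\<And>n x. x \<in> topspace X \<Longrightarrow> 0 \<le> g n x \<and> g n x \<le> 1"
    and "\<And>x. x \<in> topspace X \<Longrightarrow> (\<lambda>n. g n x) \<longlonglongrightarrow> indicator F x"
proof -
  have FX: "F \<subseteq> topspace X" using F by (rule closedin_subset)
  obtain \<U> where "countable \<U>" and op: "\<U> \<subseteq> Collect (openin X)" and "\<Inter>\<U> = F"
    using closed_imp_gdelta_in[OF X F] unfolding gdelta_in_alt intersection_of_def by blast
  define U where "U = from_nat_into (insert (topspace X) \<U>)"
  have U: "range U = insert (topspace X) \<U>"
    unfolding U_def using \<open>countable \<U>\<close> by (intro range_from_nat_into) auto
  then have Uop: "openin X (U n)" for n
    using op by (metis (no_types, lifting) insertE mem_Collect_eq openin_topspace rangeI subsetD)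
  have UF: "F = (\<Inter>n. U n)"
    using U \<open>\<Inter>\<U> = F\<close> FX by auto
  have "\<exists>f. continuous_map X (top_of_set {0..1::real}) f \<and> f ` (topspace X - U n) \<subseteq> {0} \<and> f ` F \<subseteq> {1}" for n
  proof -
    have "disjnt (topspace X - U n) F" using UF by (auto simp: disjnt_def)
    with Urysohn_lemma[OF metrizable_imp_normal_space[OF X] _ F, of "topspace X - U n" 0 1] show ?thesis
      using Uop[of n] by (metis closedin_diff closedin_topspace zero_le_one)
  qed
  then obtain f where f: "\<And>n. continuous_map X (top_of_set {0..1::real}) (f n)"
    and f0: "\<And>n. f n ` (topspace X - U n) \<subseteq> {0}" and f1: "\<And>n. f n ` F \<subseteq> {1}"
    by metis
  have fb: "0 \<le> f n x \<and> f n x \<le> 1" if "x \<in> topspace X" for n x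
    using f[of n] that by (auto simp: continuous_map_in_subtopology)
  show ?thesis
  proof (rule that)
    show "continuous_map X euclideanreal (\<lambda>x. \<Prod>k\<le>n. f k x)" for n
      using f by (intro continuous_map_prod) (auto simp: continuous_map_in_subtopology)
    show "0 \<le> (\<Prod>k\<le>n. f k x) \<and> (\<Prod>k\<le>n. f k x) \<le> 1" if "x \<in> topspace X" for n x
      using fb[OF that] by (auto intro: prod_nonneg prod_le_1)
    show "(\<lambda>n. \<Prod>k\<le>n. f k x) \<longlonglongrightarrow> indicator F x" if x: "x \<in> topspace X" for x
    proof (cases "x \<in> F")
      case True
      then have "f n x = 1" for n using f1 by blast
      then show ?thesis using True by simp
    next
      case False
      then obtain m where "x \<notin> U m" using UF by blast
      then have "f m x = 0" using f0 x by blast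
      then have "(\<Prod>k\<le>n. f k x) = 0" if "m \<le> n" for n
        using that by (auto simp: prod_zero_iff)
      then have "eventually (\<lambda>n. (\<Prod>k\<le>n. f k x) = indicator F x) sequentially"
        using False by (auto simp: eventually_sequentially)
      then show ?thesis by (rule tendsto_eventually)
    qed
  qed
qed

lemma signed_integral_indicator_limit:
  assumes \<mu>: "finite_signed X \<mu>" and A: "A \<in> sets (borel_of X)"
    and g: "\<And>n::nat. continuous_map X euclideanreal (g n)"
    and bd: "\<And>n x. x \<in> topspace X \<Longrightarrow> 0 \<le> g n x \<and> g n x \<le> 1"
    and lim: "\<And>x. x \<in> topspace X \<Longrightarrow> (\<lambda>n. g n x) \<longlonglongrightarrow> indicator A x"
  shows "(\<lambda>n. signed_integral X \<mu> (g n)) \<longlonglongrightarrow> \<mu> A"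
proof -
  have AX: "A \<inter> topspace X = A" using sets.sets_into_space[OF A] by auto
  have "(\<lambda>n. integral\<^sup>L M (g n)) \<longlonglongrightarrow> measure M A"
    if M: "finite_measure M" "sets M = sets (borel_of X)" for M
  proof -
    have sp: "space M = topspace X" using sets_eq_imp_space_eq[OF M(2)] by simp
    interpret finite_measure M by fact
    have gm: "g n \<in> borel_measurable M" for n
      using continuous_map_borel_measurable[OF g] M(2) by (metis measurable_cong_sets)
    have "(\<lambda>n. integral\<^sup>L M (g n)) \<longlonglongrightarrow> integral\<^sup>L M (indicator A)"
      by (rule integral_dominated_convergence[where w="\<lambda>x. 1"])
         (use A M(2) gm bd lim in \<open>auto simp: sp\<close>)
    then show ?thesis by (simp add: sp AX)
  qed
  then show ?thesis
    using \<mu> unfolding signed_integral_def jordan_decomposition[OF \<mu> A]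
    by (intro tendsto_diff) (auto simp: finite_signed_def)
qed

lemma signed_measure_eqI:
  assumes X: "metrizable_space X" and \<mu>: "finite_signed X \<mu>" and \<nu>: "finite_signed X \<nu>"
    and eq: "\<And>g. continuous_map X euclideanreal g \<Longrightarrow> (\<And>x. x \<in> topspace X \<Longrightarrow> 0 \<le> g x \<and> g x \<le> 1) \<Longrightarrow>
      signed_integral X \<mu> g = signed_integral X \<nu> g"
    and A: "A \<in> sets (borel_of X)"
  shows "\<mu> A = \<nu> A"
proof -
  have s: "signed_measure X \<mu>" "signed_measure X \<nu>"
    using \<mu> \<nu> unfolding finite_signed_def by auto
  have closed: "\<mu> F = \<nu> F" if F: "closedin X F" for F
  proof -
    obtain g :: "nat \<Rightarrow> 'a \<Rightarrow> real" where g: "\<And>n. continuous_map X euclideanreal (g n)"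
      "\<And>n x. x \<in> topspace X \<Longrightarrow> 0 \<le> g n x \<and> g n x \<le> 1"
      "\<And>x. x \<in> topspace X \<Longrightarrow> (\<lambda>n. g n x) \<longlonglongrightarrow> indicator F x"
      using closed_indicator_limit[OF X F] by metis
    have "(\<lambda>n. signed_integral X \<mu> (g n)) \<longlonglongrightarrow> \<mu> F"
      by (rule signed_integral_indicator_limit[OF \<mu> closedin_borel_of[OF F] g])
    moreover have "(\<lambda>n. signed_integral X \<nu> (g n)) \<longlonglongrightarrow> \<nu> F"
      by (rule signed_integral_indicator_limit[OF \<nu> closedin_borel_of[OF F] g])
    moreover have "signed_integral X \<mu> (g n) = signed_integral X \<nu> (g n)" for n
      by (rule eq) (use g in auto)
    ultimately show ?thesis
      using LIMSEQ_unique by (metis (no_types, lifting) ext)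
  qed
  have top: "topspace X \<in> sets (borel_of X)" by (simp add: openin_borel_of)
  have Xeq: "\<mu> (topspace X) = \<nu> (topspace X)" by (rule closed) simp
  have diff: "\<mu> (topspace X - B) = \<nu> (topspace X - B)" if "B \<in> sets (borel_of X)" "\<mu> B = \<nu> B" for B
    using signed_measure_Diff[OF s(1) top that(1)] signed_measure_Diff[OF s(2) top that(1)]
      sets.sets_into_space[OF that(1)] that(2) Xeq by simp
  have "Int_stable {U. openin X U}" by (auto simp: Int_stable_def)
  moreover have "{U. openin X U} \<subseteq> Pow (topspace X)" by (auto dest: openin_subset)
  moreover have "A \<in> sigma_sets (topspace X) {U. openin X U}"
    using A by (simp add: sets_borel_of)
  ultimately show ?thesis
  proof (induction rule: sigma_sets_induct_disjoint)
    case (basic U)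
    then have U: "openin X U" by simp
    then have "U = topspace X - (topspace X - U)" using openin_subset by blast
    moreover have "closedin X (topspace X - U)" using U by blast
    ultimately show ?case using diff[OF closedin_borel_of closed] by metis
  next
    case empty
    show ?case using signed_measure_empty s by metis
  next
    case (compl B)
    then show ?case using diff[of B] by (simp add: sets_borel_of)
  next
    case (union A)
    have "\<And>n. A n \<in> sets (borel_of X)" using union(2) unfolding sets_borel_of by blast
    from signed_measureD[OF s(1) this union(1)] signed_measureD[OF s(2) this union(1)] union(3)
    show ?case by (simp add: sums_unique2)
  qed
qed

section \<open>Weighted function and measure spaces\<close>

lemma finite_measure_integrable_ge_1:
  fixes f :: "'a \<Rightarrow> real"
  assumes "integrable M f" "\<And>x. x \<in> space M \<Longrightarrow> 1 \<le> f x"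
  shows "finite_measure M"
proof (rule finite_measureI)
  have "emeasure M (space M) = (\<integral>\<^sup>+ x. 1 \<partial>M)" by simp
  also have "\<dots> \<le> (\<integral>\<^sup>+ x. norm (f x) \<partial>M)"
    using assms(2) by (intro nn_integral_mono) (force simp: ennreal_1[symmetric] simp del: ennreal_1 intro: ennreal_leI)
  also have "\<dots> < \<infinity>" using assms(1) by (simp add: integrable_iff_bounded)
  finally show "emeasure M (space M) \<noteq> \<infinity>" by simp
qed

lemma weighted_M_finite_signed:
  assumes "\<nu> \<in> weighted_M X \<psi>" "\<And>s. s \<in> topspace X \<Longrightarrow> 1 \<le> \<psi> s"
  shows "finite_signed X (\<lambda>A. \<nu> A $ i)"
proof -
  have "signed_measure X (\<lambda>A. \<nu> A $ i)"
    using assms(1) unfolding weighted_M_def vector_measures_def signed_measure_def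
    by (auto intro: bounded_linear.sums[OF bounded_linear_vec_nth])
  then show ?thesis
    using assms unfolding finite_signed_def weighted_M_def signed_integrable_def
    by (auto intro!: finite_measure_integrable_ge_1[where f=\<psi>])
qed

lemma weighted_C_iff:
  assumes "\<And>s. s \<in> topspace X \<Longrightarrow> 1 \<le> \<psi> s"
  shows "u \<in> weighted_C X \<psi> \<longleftrightarrow>
    continuous_map X euclidean u \<and> (\<exists>B. \<forall>s\<in>topspace X. norm (u s) \<le> B * \<psi> s)"
proof -
  have "norm (u s /\<^sub>R \<psi> s) \<le> B \<longleftrightarrow> norm (u s) \<le> B * \<psi> s" if "s \<in> topspace X" for s B
    using assms[OF that] by (simp add: divide_simps mult.commute)
  then show ?thesis
    unfolding weighted_C_def bounded_iff by auto
qed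

lemma weighted_C_sum:
  assumes \<psi>: "\<And>s. s \<in> topspace X \<Longrightarrow> 1 \<le> \<psi> s"
    and J: "finite J" and u: "\<And>j. j \<in> J \<Longrightarrow> u j \<in> weighted_C X \<psi>"
  shows "(\<lambda>s. \<Sum>j\<in>J. a j *\<^sub>R u j s) \<in> weighted_C X \<psi>"
proof -
  have "\<forall>j\<in>J. \<exists>B. \<forall>s\<in>topspace X. norm (u j s) \<le> B * \<psi> s"
    using u weighted_C_iff[of X \<psi>, OF \<psi>] by blast
  then obtain B where B: "\<And>j s. j \<in> J \<Longrightarrow> s \<in> topspace X \<Longrightarrow> norm (u j s) \<le> B j * \<psi> s"
    by metis
  have "norm (\<Sum>j\<in>J. a j *\<^sub>R u j s) \<le> (\<Sum>j\<in>J. \<bar>a j\<bar> * B j) * \<psi> s" if s: "s \<in> topspace X" for s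
  proof -
    have "norm (\<Sum>j\<in>J. a j *\<^sub>R u j s) \<le> (\<Sum>j\<in>J. \<bar>a j\<bar> * norm (u j s))"
      by (rule order_trans[OF norm_sum]) simp
    also have "\<dots> \<le> (\<Sum>j\<in>J. \<bar>a j\<bar> * (B j * \<psi> s))"
      by (intro sum_mono mult_left_mono B s) auto
    finally show ?thesis by (simp add: sum_distrib_right mult.assoc)
  qed
  moreover have "continuous_map X euclidean (\<lambda>s. \<Sum>j\<in>J. a j *\<^sub>R u j s)"
    using u weighted_C_iff[of X \<psi>, OF \<psi>] J
    by (intro continuous_map_sum continuous_map_linear[OF bounded_linear_scaleR_right]) blast+
  ultimately show ?thesis
    using weighted_C_iff[of X \<psi>, OF \<psi>] by blast
qed

lemma weighted_signed_integrable:
  fixes u :: "'a \<Rightarrow> real ^ 'd"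
  assumes \<psi>: "\<And>s. s \<in> topspace X \<Longrightarrow> 1 \<le> \<psi> s"
    and \<nu>: "\<nu> \<in> weighted_M X \<psi>" and u: "u \<in> weighted_C X \<psi>"
  shows "signed_integrable X (\<lambda>A. \<nu> A $ i) (\<lambda>s. u s $ j)"
proof -
  obtain B where cont: "continuous_map X euclidean u"
    and B: "\<And>s. s \<in> topspace X \<Longrightarrow> norm (u s) \<le> B * \<psi> s"
    using u weighted_C_iff[of X \<psi>, OF \<psi>] by blast
  have "(\<lambda>s. u s $ j) \<in> borel_measurable (borel_of X)"
    by (intro continuous_map_borel_measurable continuous_map_linear[OF bounded_linear_vec_nth cont])
  then have meas: "(\<lambda>s. u s $ j) \<in> borel_measurable (upper_variation X \<mu>)" for \<mu>
    by (metis measurable_cong_sets sets_upper_variation)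
  have bd: "norm (u s $ j) \<le> norm (B * \<psi> s)" if "s \<in> topspace X" for s
    using B[OF that] component_le_norm_cart[of "u s" j] by simp
  have int: "integrable (upper_variation X \<mu>) (\<lambda>s. u s $ j)"
    if "integrable (upper_variation X \<mu>) \<psi>" for \<mu>
    by (rule Bochner_Integration.integrable_bound[where f="\<lambda>s. B * \<psi> s"])
       (use that meas bd in auto)
  show ?thesis
    using \<nu> int unfolding weighted_M_def signed_integrable_def by blast
qed

lemma pairing_sum:
  fixes u :: "'j \<Rightarrow> 'a \<Rightarrow> real ^ 'd"
  assumes \<psi>: "\<And>s. s \<in> topspace X \<Longrightarrow> 1 \<le> \<psi> s"
    and \<nu>: "\<nu> \<in> weighted_M X \<psi>" and u: "\<And>j. j \<in> J \<Longrightarrow> u j \<in> weighted_C X \<psi>"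
  shows "pairing X (\<lambda>s. \<Sum>j\<in>J. a j *\<^sub>R u j s) \<nu> = (\<Sum>j\<in>J. a j * pairing X (u j) \<nu>)"
proof -
  have int: "integrable (upper_variation X (\<lambda>A. \<nu> A $ i)) (\<lambda>s. u j s $ i)"
    "integrable (upper_variation X (\<lambda>A. - \<nu> A $ i)) (\<lambda>s. u j s $ i)" if "j \<in> J" for i j
    using weighted_signed_integrable[OF \<psi> \<nu> u[OF that]] unfolding signed_integrable_def by auto
  have "signed_integral X (\<lambda>A. \<nu> A $ i) (\<lambda>s. (\<Sum>j\<in>J. a j *\<^sub>R u j s) $ i)
      = (\<Sum>j\<in>J. a j * signed_integral X (\<lambda>A. \<nu> A $ i) (\<lambda>s. u j s $ i))" for i
    using int unfolding signed_integral_def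
    by (simp add: integral_sum right_diff_distrib sum_subtractf)
  then show ?thesis
    unfolding pairing_def sum_distrib_left by (simp add: sum.swap[of _ UNIV])
qed

lemma pairing_convex:
  assumes \<psi>: "\<And>s. s \<in> topspace X \<Longrightarrow> 1 \<le> \<psi> s"
    and u: "u \<in> weighted_C X \<psi>" and \<mu>: "\<mu> \<in> weighted_M X \<psi>" and \<nu>: "\<nu> \<in> weighted_M X \<psi>"
    and m: "(\<lambda>A. a *\<^sub>R \<mu> A + b *\<^sub>R \<nu> A) \<in> weighted_M X \<psi>"
  shows "pairing X u (\<lambda>A. a *\<^sub>R \<mu> A + b *\<^sub>R \<nu> A) = a * pairing X u \<mu> + b * pairing X u \<nu>"
proof -
  define m where "m = (\<lambda>A. a *\<^sub>R \<mu> A + b *\<^sub>R \<nu> A)"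
  have m': "m \<in> weighted_M X \<psi>" using m unfolding m_def .
  have "signed_integral X (\<lambda>A. m A $ i) (\<lambda>s. u s $ i)
     = a * signed_integral X (\<lambda>A. \<mu> A $ i) (\<lambda>s. u s $ i) + b * signed_integral X (\<lambda>A. \<nu> A $ i) (\<lambda>s. u s $ i)" for i
  proof -
    \<comment> \<open>The three measures satisfy \<open>- m + a * \<mu> + b * \<nu> = 0\<close> in each component.\<close>
    define M where "M = (\<lambda>k::nat. [m, \<mu>, \<nu>] ! k)"
    define c where "c = (\<lambda>k::nat. [-1, a, b] ! k)"
    have I: "{..<3} = {0, 1, 2::nat}" by auto
    have "\<forall>k\<in>{..<3}. M k \<in> weighted_M X \<psi>"
      unfolding I M_def using m' \<mu> \<nu> by simp
    then have M: "M k \<in> weighted_M X \<psi>" if "k \<in> {..<3}" for k using that by blast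
    have "(\<Sum>k<3. c k * signed_integral X (\<lambda>A. M k A $ i) (\<lambda>s. u s $ i)) = 0"
    proof (intro signed_integral_linear_relation)
      fix A show "(\<Sum>k<3. c k * M k A $ i) = 0"
        unfolding I c_def M_def by (simp add: m_def)
    qed (auto intro: weighted_M_finite_signed[OF M \<psi>] weighted_signed_integrable[OF \<psi> M u])
    then show ?thesis unfolding I c_def M_def by simp
  qed
  then show ?thesis
    unfolding pairing_def m_def[symmetric] by (simp add: sum.distrib sum_distrib_left)
qed

section \<open>Image measures\<close>

text \<open>
  The image of \<open>\<mu>\<close> is the difference of the images of its two variations. These need not be the
  variations of the image, since mass may cancel.
\<close>
lemma signed_pushforward:
  assumes \<mu>: "finite_signed X \<mu>" and p: "continuous_map X Y p"
    and \<mu>': "\<And>A. A \<in> sets (borel_of Y) \<Longrightarrow> \<mu>' A = \<mu> {s \<in> topspace X. p s \<in> A}"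
  shows "finite_signed Y \<mu>'"
    and "f \<in> borel_measurable (borel_of Y) \<Longrightarrow> signed_integrable X \<mu> (\<lambda>s. f (p s)) \<Longrightarrow>
      signed_integral Y \<mu>' f = signed_integral X \<mu> (\<lambda>s. f (p s))"
proof -
  have pm: "p \<in> measurable (borel_of X) (borel_of Y)"
    by (rule continuous_map_measurable[OF p])
  then have pm': "p \<in> measurable (upper_variation X \<nu>) (borel_of Y)" for \<nu>
    by (metis measurable_cong_sets sets_upper_variation)
  have pre: "{s \<in> topspace X. p s \<in> A} \<in> sets (borel_of X)" if "A \<in> sets (borel_of Y)" for A
    using measurable_sets[OF pm that] by (simp add: vimage_def Int_def conj_commute)
  have s: "signed_measure X \<mu>" and fin: "finite_measure (upper_variation X \<mu>)"
      "finite_measure (upper_variation X (\<lambda>A. - \<mu> A))"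
    using \<mu> unfolding finite_signed_def by auto
  have s': "signed_measure Y \<mu>'"
    unfolding signed_measure_def
  proof (intro allI impI)
    fix A :: "nat \<Rightarrow> 'b set" assume A: "range A \<subseteq> sets (borel_of Y)" and d: "disjoint_family A"
    then have A': "\<And>n. A n \<in> sets (borel_of Y)" by blast
    then have UA: "(\<Union>n. A n) \<in> sets (borel_of Y)" by (intro sets.countable_UN) auto
    have "(\<lambda>n. \<mu> {s \<in> topspace X. p s \<in> A n}) sums \<mu> (\<Union>n. {s \<in> topspace X. p s \<in> A n})"
      by (rule signed_measureD[OF s pre[OF A']]) (use d in \<open>auto simp: disjoint_family_on_def\<close>)
    also have "(\<Union>n. {s \<in> topspace X. p s \<in> A n}) = {s \<in> topspace X. p s \<in> (\<Union>n. A n)}" by auto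
    finally show "(\<lambda>n. \<mu>' (A n)) sums \<mu>' (\<Union>n. A n)"
      using \<mu>'[OF A'] \<mu>'[OF UA] by simp
  qed
  let ?P = "distr (upper_variation X \<mu>) (borel_of Y) p"
  let ?N = "distr (upper_variation X (\<lambda>A. - \<mu> A)) (borel_of Y) p"
  have eq: "\<mu>' A = measure ?P A - measure ?N A" if A: "A \<in> sets (borel_of Y)" for A
  proof -
    have "p -` A \<inter> topspace X = {s \<in> topspace X. p s \<in> A}" by auto
    then show ?thesis
      by (simp add: measure_distr[OF pm' A] \<mu>'[OF A] jordan_decomposition[OF \<mu> pre[OF A]])
  qed
  note PN = signed_integral_diff_measures[OF s' finite_measure.finite_measure_distr[OF fin(1) pm']
      sets_distr finite_measure.finite_measure_distr[OF fin(2) pm'] sets_distr eq]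
  show "finite_signed Y \<mu>'" by (rule PN(1))
  assume f: "f \<in> borel_measurable (borel_of Y)" and int: "signed_integrable X \<mu> (\<lambda>s. f (p s))"
  show "signed_integral Y \<mu>' f = signed_integral X \<mu> (\<lambda>s. f (p s))"
    using PN(2)[of f] int
    by (simp add: integrable_distr_eq[OF pm' f] integral_distr[OF pm' f]
        signed_integrable_def signed_integral_def)
qed

lemma pairing_pushforward:
  fixes u :: "'b \<Rightarrow> real ^ 'd"
  assumes \<psi>: "\<And>s. s \<in> topspace X \<Longrightarrow> 1 \<le> \<psi> s"
    and \<nu>: "\<nu> \<in> weighted_M X \<psi>" and p: "continuous_map X Y p"
    and \<nu>': "\<And>A. A \<in> sets (borel_of Y) \<Longrightarrow> \<nu>' A = \<nu> {s \<in> topspace X. p s \<in> A}"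
    and u: "continuous_map Y euclidean u" and up: "(\<lambda>s. u (p s)) \<in> weighted_C X \<psi>"
  shows "pairing Y u \<nu>' = pairing X (\<lambda>s. u (p s)) \<nu>"
  unfolding pairing_def
proof (rule sum.cong[OF refl])
  fix i
  show "signed_integral Y (\<lambda>A. \<nu>' A $ i) (\<lambda>s. u s $ i)
      = signed_integral X (\<lambda>A. \<nu> A $ i) (\<lambda>s. u (p s) $ i)"
    by (rule signed_pushforward(2)[OF weighted_M_finite_signed[OF \<nu> \<psi>] p])
       (auto simp: \<nu>' intro!: continuous_map_borel_measurable u
          continuous_map_linear[OF bounded_linear_vec_nth] weighted_signed_integrable[OF \<psi> \<nu> up])
qed

lemma pairing_axis:
  "pairing X (\<lambda>s. axis i (g s)) \<nu> = signed_integral X (\<lambda>A. \<nu> A $ i) g"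
proof -
  have "signed_integral X (\<lambda>A. \<nu> A $ j) (\<lambda>s. axis i (g s) $ j)
      = (if j = i then signed_integral X (\<lambda>A. \<nu> A $ i) g else 0)" for j
    by (auto simp: axis_def signed_integral_def)
  then show ?thesis unfolding pairing_def by simp
qed

text \<open>
  Testing against \<open>axis i (g s)\<close> with \<open>0 \<le> g \<le> 1\<close> isolates the component \<open>i\<close>; such
  functions belong to the weighted space because the weight is at least 1.
\<close>
lemma vector_measure_eqI:
  fixes \<mu> \<nu> :: "'a set \<Rightarrow> real ^ 'd"
  assumes X: "metrizable_space X" and \<psi>: "\<And>s. s \<in> topspace X \<Longrightarrow> 1 \<le> \<psi> s"
    and \<mu>: "\<And>i. finite_signed X (\<lambda>A. \<mu> A $ i)" "\<And>A. A \<notin> sets (borel_of X) \<Longrightarrow> \<mu> A = 0"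
    and \<nu>: "\<And>i. finite_signed X (\<lambda>A. \<nu> A $ i)" "\<And>A. A \<notin> sets (borel_of X) \<Longrightarrow> \<nu> A = 0"
    and eq: "\<And>u. u \<in> weighted_C X \<psi> \<Longrightarrow> pairing X u \<mu> = pairing X u \<nu>"
  shows "\<mu> = \<nu>"
proof
  fix A
  show "\<mu> A = \<nu> A"
  proof (cases "A \<in> sets (borel_of X)")
    case True
    have "\<mu> A $ i = \<nu> A $ i" for i
    proof (rule signed_measure_eqI[OF X \<mu>(1) \<nu>(1) _ True])
      fix g assume g: "continuous_map X euclideanreal g" "\<And>x. x \<in> topspace X \<Longrightarrow> 0 \<le> g x \<and> g x \<le> 1"
      have axis: "(\<lambda>s. axis i (g s)) = (\<lambda>s. g s *\<^sub>R (axis i 1 :: real ^ 'd))"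
        by (simp add: axis_def vec_eq_iff fun_eq_iff)
      have "continuous_map X euclidean (\<lambda>s. axis i (g s) :: real ^ 'd)"
        unfolding axis by (rule continuous_map_linear[OF bounded_linear_scaleR_left g(1)])
      moreover have "norm (axis i (g s) :: real ^ 'd) \<le> 1 * \<psi> s" if "s \<in> topspace X" for s
        using fun_cong[OF axis, of s] g(2)[OF that] \<psi>[OF that] by (simp add: norm_axis_1)
      ultimately have "(\<lambda>s. axis i (g s) :: real ^ 'd) \<in> weighted_C X \<psi>"
        using weighted_C_iff[of X \<psi>, OF \<psi>] by blast
      from eq[OF this] show "signed_integral X (\<lambda>A. \<mu> A $ i) g = signed_integral X (\<lambda>A. \<nu> A $ i) g"
        by (simp add: pairing_axis)
    qed
    then show ?thesis by (simp add: vec_eq_iff)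
  next
    case False
    then show ?thesis using \<mu>(2) \<nu>(2) by simp
  qed
qed

section \<open>Weak compactness\<close>

lemma continuous_map_pairing:
  assumes "u \<in> weighted_C X \<psi>"
  shows "continuous_map (weak_topology X \<psi>) euclideanreal (pairing X u)"
proof -
  let ?f = "\<lambda>\<nu>. restrict (\<lambda>u. pairing X u \<nu>) (weighted_C X \<psi>)"
  have "continuous_map (weak_topology X \<psi>) euclideanreal ((\<lambda>h. h u) \<circ> ?f)"
    unfolding weak_topology_def
    by (rule continuous_map_pullback) (rule continuous_map_product_projection[OF assms])
  then show ?thesis using assms by (simp add: o_def)
qed

lemma continuous_map_attains_sup:
  fixes f :: "'a \<Rightarrow> real"
  assumes K: "compactin W K" "K \<noteq> {}" and f: "continuous_map W euclideanreal f"
  obtains k where "k \<in> K" "\<And>l. l \<in> K \<Longrightarrow> f l \<le> f k"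
proof -
  have "compact (f ` K)" using image_compactin[OF K(1) f] by simp
  from compact_attains_sup[OF this] K(2) that show ?thesis by auto
qed

lemma support_fun_attained:
  assumes "compactin (weak_topology X \<psi>) \<Lambda>" "\<Lambda> \<noteq> {}" "u \<in> weighted_C X \<psi>"
  obtains \<nu> where "\<nu> \<in> \<Lambda>" "support_fun X \<Lambda> u = ereal (pairing X u \<nu>)"
proof -
  obtain \<nu> where \<nu>: "\<nu> \<in> \<Lambda>" "\<And>\<mu>. \<mu> \<in> \<Lambda> \<Longrightarrow> pairing X u \<mu> \<le> pairing X u \<nu>"
    using continuous_map_attains_sup[OF assms(1,2) continuous_map_pairing[OF assms(3)]] by blast
  have "support_fun X \<Lambda> u = ereal (pairing X u \<nu>)"
    unfolding support_fun_def using \<nu> by (intro antisym SUP_least SUP_upper) auto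
  with \<nu>(1) that show ?thesis by blast
qed

text \<open>
  A separation theorem that needs no vector space structure: convexity enters only through
  existence of points at which all the functions interpolate. By the finite intersection property,
  finitely many functions \<open>\<Phi> x\<close> suffice. For these, take \<open>k\<close> in \<open>K\<close> minimising the sum
  of squares. Were the minimum positive, the variational inequality at \<open>k\<close> would make the
  combination with coefficients \<open>- \<Phi> x k\<close> negative on all of \<open>K\<close>.
\<close>
lemma convex_compact_common_zero:
  fixes \<Phi> :: "'x \<Rightarrow> 'k \<Rightarrow> real"
  assumes K: "compactin W K" "K \<noteq> {}"
    and cont: "\<And>x. x \<in> D \<Longrightarrow> continuous_map W euclideanreal (\<Phi> x)"
    and conv: "\<And>k l a. k \<in> K \<Longrightarrow> l \<in> K \<Longrightarrow> 0 \<le> a \<Longrightarrow> a \<le> 1 \<Longrightarrow>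
      \<exists>m\<in>K. \<forall>x\<in>D. \<Phi> x m = (1 - a) * \<Phi> x k + a * \<Phi> x l"
    and pos: "\<And>F c. finite F \<Longrightarrow> F \<subseteq> D \<Longrightarrow> \<exists>k\<in>K. (\<Sum>x\<in>F. c x * \<Phi> x k) \<ge> 0"
  shows "\<exists>k\<in>K. \<forall>x\<in>D. \<Phi> x k = 0"
proof -
  have fin: "\<exists>k\<in>K. \<forall>x\<in>F. \<Phi> x k = 0" if F: "finite F" "F \<subseteq> D" for F
  proof -
    define q where "q = (\<lambda>k. \<Sum>x\<in>F. (\<Phi> x k)\<^sup>2)"
    have "continuous_map W euclideanreal (\<lambda>k. - q k)"
      unfolding q_def using F cont
      by (intro continuous_map_minus continuous_map_sum continuous_map_real_pow) auto
    then obtain k where k: "k \<in> K" "\<And>l. l \<in> K \<Longrightarrow> q k \<le> q l"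
      using continuous_map_attains_sup[OF K] by (metis neg_le_iff_le)
    have "q k = 0"
    proof (rule ccontr)
      assume "q k \<noteq> 0"
      then have qk: "q k > 0" unfolding q_def by (simp add: order_less_le sum_nonneg)
      obtain l where l: "l \<in> K" and "(\<Sum>x\<in>F. - \<Phi> x k * \<Phi> x l) \<ge> 0"
        using pos[OF F, of "\<lambda>x. - \<Phi> x k"] by blast
      then have kl: "(\<Sum>x\<in>F. \<Phi> x k * \<Phi> x l) \<le> 0" by (simp add: sum_negf)
      have ql: "q l \<ge> 0" unfolding q_def by (simp add: sum_nonneg)
      \<comment> \<open>The point of the segment that minimises \<open>(1 - a)\<^sup>2 * q k + a\<^sup>2 * q l\<close>.\<close>
      define a where "a = q k / (q k + q l)"
      have a: "0 < a" "a \<le> 1" and a': "a * (q k + q l) = q k"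
        using qk ql unfolding a_def by (auto simp: divide_simps)
      obtain m where m: "m \<in> K" "\<And>x. x \<in> D \<Longrightarrow> \<Phi> x m = (1 - a) * \<Phi> x k + a * \<Phi> x l"
        using conv[OF k(1) l, of a] a by auto
      have "q m = (\<Sum>x\<in>F. (1 - a)\<^sup>2 * (\<Phi> x k)\<^sup>2 + 2 * a * (1 - a) * (\<Phi> x k * \<Phi> x l) + a\<^sup>2 * (\<Phi> x l)\<^sup>2)"
        unfolding q_def
      proof (rule sum.cong[OF refl])
        fix x assume "x \<in> F"
        then have "\<Phi> x m = (1 - a) * \<Phi> x k + a * \<Phi> x l" using m(2) F(2) by blast
        then show "(\<Phi> x m)\<^sup>2
            = (1 - a)\<^sup>2 * (\<Phi> x k)\<^sup>2 + 2 * a * (1 - a) * (\<Phi> x k * \<Phi> x l) + a\<^sup>2 * (\<Phi> x l)\<^sup>2"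
          by (simp only:) (simp add: power2_eq_square algebra_simps)
      qed
      also have "\<dots> = (1 - a)\<^sup>2 * q k + 2 * a * (1 - a) * (\<Sum>x\<in>F. \<Phi> x k * \<Phi> x l) + a\<^sup>2 * q l"
        unfolding q_def by (simp add: sum.distrib sum_distrib_left)
      also have "\<dots> \<le> (1 - a)\<^sup>2 * q k + a\<^sup>2 * q l"
        using a kl by (simp add: mult_nonneg_nonpos)
      also have "\<dots> = q k - 2 * a * q k + a * (a * (q k + q l))"
        by (simp add: power2_eq_square algebra_simps)
      also have "\<dots> = q k - a * q k" unfolding a' by simp
      also have "\<dots> < q k" using a qk by simp
      finally show False using k(2)[OF m(1)] by simp
    qed
    then have "\<forall>x\<in>F. \<Phi> x k = 0"
      unfolding q_def using F(1) by (simp add: sum_nonneg_eq_0_iff)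
    then show ?thesis using k(1) by blast
  qed
  define Z where "Z = (\<lambda>x. {k \<in> topspace W. \<Phi> x k = 0})"
  have KW: "K \<subseteq> topspace W" using K(1) by (rule compactin_subset_topspace)
  have "K \<inter> \<Inter>(Z ` D) \<noteq> {}"
  proof (rule K(1)[unfolded compactin_fip, THEN conjunct2, rule_format])
    have "closedin W (Z x)" if "x \<in> D" for x
      using closedin_continuous_map_preimage[OF cont[OF that], of "{0}"] by (simp add: Z_def)
    moreover have "K \<inter> \<Inter>\<F> \<noteq> {}" if \<F>: "finite \<F>" "\<F> \<subseteq> Z ` D" for \<F>
    proof -
      obtain F where F: "finite F" "F \<subseteq> D" "\<F> = Z ` F"
        using finite_subset_image[OF \<F>] by blast
      obtain k where "k \<in> K" "\<forall>x\<in>F. \<Phi> x k = 0" using fin[OF F(1,2)] by blast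
      then have "k \<in> K \<inter> \<Inter>\<F>" using KW F(3) by (auto simp: Z_def)
      then show ?thesis by blast
    qed
    ultimately show "(\<forall>C\<in>Z ` D. closedin W C) \<and> (\<forall>\<F>. finite \<F> \<and> \<F> \<subseteq> Z ` D \<longrightarrow> K \<inter> \<Inter>\<F> \<noteq> {})"
      by blast
  qed
  then show ?thesis by (auto simp: Z_def)
qed

lemma pairing_zero: "pairing X (\<lambda>s. 0) \<nu> = 0"
  by (simp add: pairing_def signed_integral_def)

lemma zero_weighted_C: "(\<lambda>s. 0) \<in> weighted_C X \<psi>"
  by (auto simp: weighted_C_def bounded_iff)

lemma support_fun_zero: "support_fun X \<Lambda> (\<lambda>s. 0) \<le> 0"
  unfolding support_fun_def pairing_zero by (auto intro!: SUP_least simp: zero_ereal_def)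

lemma support_fun_upper: "\<nu> \<in> \<Lambda> \<Longrightarrow> ereal (pairing X u \<nu>) \<le> support_fun X \<Lambda> u"
  unfolding support_fun_def by (rule SUP_upper)

section \<open>Path space and marginals\<close>

text \<open>Metrizable factors \<open>S 0, \<dots>, S T\<close>, each with a weight that is at least 1.\<close>
locale marginal_setting =
  fixes S :: "nat \<Rightarrow> 'a topology" and T :: nat and \<psi> :: "nat \<Rightarrow> 'a \<Rightarrow> real"
  assumes metrizable: "\<And>t. t \<le> T \<Longrightarrow> metrizable_space (S t)"
    and weight_ge_1: "\<And>t s. t \<le> T \<Longrightarrow> s \<in> topspace (S t) \<Longrightarrow> 1 \<le> \<psi> t s"
begin

abbreviation P where "P \<equiv> path_space S T"
abbreviation \<Psi> where "\<Psi> \<equiv> sum_weight \<psi> T"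

lemma coordinate: "s \<in> topspace P \<Longrightarrow> t \<le> T \<Longrightarrow> s t \<in> topspace (S t)"
  by (auto simp: path_space_def)

lemma continuous_coordinate: "t \<le> T \<Longrightarrow> continuous_map P (S t) (\<lambda>s. s t)"
  unfolding path_space_def by (rule continuous_map_product_projection) simp

lemma weight_le_sum:
  assumes "s \<in> topspace P" "t \<le> T"
  shows "\<psi> t (s t) \<le> \<Psi> s"
  unfolding sum_weight_def
proof (rule member_le_sum)
  show "0 \<le> \<psi> r (s r)" if "r \<in> {..T} - {t}" for r
    using weight_ge_1[of r "s r"] coordinate[OF assms(1), of r] that by auto
qed (use assms in auto)

lemma sum_weight_ge_1: "s \<in> topspace P \<Longrightarrow> 1 \<le> \<Psi> s"
  using weight_le_sum[of s 0] weight_ge_1[of 0 "s 0"] coordinate[of s 0] by simp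

lemma weighted_C_coordinate:
  assumes t: "t \<le> T" and u: "u \<in> weighted_C (S t) (\<psi> t)"
  shows "(\<lambda>s. u (s t)) \<in> weighted_C P \<Psi>"
proof -
  obtain B where u': "continuous_map (S t) euclidean u"
    and B: "\<And>s. s \<in> topspace (S t) \<Longrightarrow> norm (u s) \<le> B * \<psi> t s"
    using u weighted_C_iff[of "S t" "\<psi> t", OF weight_ge_1[OF t]] by blast
  have "norm (u (s t)) \<le> \<bar>B\<bar> * \<Psi> s" if s: "s \<in> topspace P" for s
  proof -
    have st: "s t \<in> topspace (S t)" by (rule coordinate[OF s t])
    have "norm (u (s t)) \<le> B * \<psi> t (s t)" by (rule B[OF st])
    also have "\<dots> \<le> \<bar>B\<bar> * \<psi> t (s t)"
      using weight_ge_1[OF t st] by (intro mult_right_mono) auto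
    also have "\<dots> \<le> \<bar>B\<bar> * \<Psi> s"
      using weight_le_sum[OF s t] by (intro mult_left_mono) auto
    finally show ?thesis .
  qed
  moreover have "continuous_map P euclidean (\<lambda>s. u (s t))"
    using continuous_map_compose[OF continuous_coordinate[OF t] u'] by (simp add: o_def)
  ultimately show ?thesis
    using weighted_C_iff[of P \<Psi>, OF sum_weight_ge_1] by blast
qed

lemma neg_sum_coordinates:
  assumes "\<And>t. t \<le> T \<Longrightarrow> x t \<in> weighted_C (S t) (\<psi> t)"
  shows "(\<lambda>s. - (\<Sum>t\<le>T. x t (s t))) \<in> weighted_C P \<Psi>"
    and "\<nu> \<in> weighted_M P \<Psi> \<Longrightarrow>
      pairing P (\<lambda>s. - (\<Sum>t\<le>T. x t (s t))) \<nu> = - (\<Sum>t\<le>T. pairing P (\<lambda>s. x t (s t)) \<nu>)"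
proof -
  have u: "(\<lambda>s. x t (s t)) \<in> weighted_C P \<Psi>" if "t \<in> {..T}" for t
    using weighted_C_coordinate assms that by auto
  have eq: "(\<lambda>s. - (\<Sum>t\<le>T. x t (s t))) = (\<lambda>s. \<Sum>t\<le>T. (- 1) *\<^sub>R x t (s t))"
    by (simp add: sum_negf)
  show "(\<lambda>s. - (\<Sum>t\<le>T. x t (s t))) \<in> weighted_C P \<Psi>"
    unfolding eq by (rule weighted_C_sum[OF sum_weight_ge_1 _ u]) auto
  assume \<nu>: "\<nu> \<in> weighted_M P \<Psi>"
  show "pairing P (\<lambda>s. - (\<Sum>t\<le>T. x t (s t))) \<nu> = - (\<Sum>t\<le>T. pairing P (\<lambda>s. x t (s t)) \<nu>)"
    unfolding eq using pairing_sum[OF sum_weight_ge_1 \<nu> u, where J = "{..T}" and a = "\<lambda>_. - 1"]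
    by (simp add: sum_negf)
qed

lemma pairing_marginal:
  assumes t: "t \<le> T" and \<nu>: "\<nu> \<in> weighted_M P \<Psi>" and u: "u \<in> weighted_C (S t) (\<psi> t)"
  shows "pairing (S t) u (marginal S T t \<nu>) = pairing P (\<lambda>s. u (s t)) \<nu>"
  by (rule pairing_pushforward[OF sum_weight_ge_1 \<nu> continuous_coordinate[OF t]])
     (use u weighted_C_coordinate[OF t u] in \<open>auto simp: marginal_def weighted_C_def\<close>)

text \<open>
  The marginal need not be known to lie in the weighted space: as an image measure it has finite
  variations, which is enough for uniqueness.
\<close>
lemma eq_marginalI:
  assumes t: "t \<le> T" and \<nu>: "\<nu> \<in> weighted_M P \<Psi>" and \<theta>: "\<theta> \<in> weighted_M (S t) (\<psi> t)"
    and eq: "\<And>u. u \<in> weighted_C (S t) (\<psi> t) \<Longrightarrow> pairing (S t) u \<theta> = pairing P (\<lambda>s. u (s t)) \<nu>"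
  shows "marginal S T t \<nu> = \<theta>"
proof (rule vector_measure_eqI[OF metrizable[OF t], of "\<psi> t"])
  show "finite_signed (S t) (\<lambda>A. marginal S T t \<nu> A $ i)" for i
    by (rule signed_pushforward(1)[OF weighted_M_finite_signed[OF \<nu> sum_weight_ge_1, where i = i]
          continuous_coordinate[OF t]]) (simp_all add: marginal_def)
  show "finite_signed (S t) (\<lambda>A. \<theta> A $ i)" for i
    by (rule weighted_M_finite_signed[OF \<theta> weight_ge_1[OF t]])
  show "\<theta> A = 0" if "A \<notin> sets (borel_of (S t))" for A
    using \<theta> that unfolding weighted_M_def vector_measures_def by blast
qed (use weight_ge_1[OF t] pairing_marginal[OF t \<nu>] eq in \<open>auto simp: marginal_def\<close>)

text \<open>
  The defect of the marginal constraints, tested with \<open>x\<close>, of a measure \<open>\<nu>\<close> on path space and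
  candidate marginals \<open>\<theta>\<close>. For measures and test functions from the weighted spaces, it
  vanishes for all \<open>x\<close> exactly when \<open>\<theta>\<close> consists of the
  marginals of \<open>\<nu>\<close>.
\<close>
definition gap where
  "gap x = (\<lambda>(\<nu>, \<theta>). (\<Sum>t\<le>T. pairing (S t) (x t) (\<theta> t))
     + pairing P (\<lambda>s. - (\<Sum>t\<le>T. x t (s t))) \<nu>)"

lemma continuous_map_gap:
  assumes "x \<in> (\<Pi> t\<in>{..T}. weighted_C (S t) (\<psi> t))"
  shows "continuous_map (prod_topology (weak_topology P \<Psi>)
      (product_topology (\<lambda>t. weak_topology (S t) (\<psi> t)) {..T})) euclideanreal (gap x)"
proof -
  let ?V = "product_topology (\<lambda>t. weak_topology (S t) (\<psi> t)) {..T}"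
  let ?W = "prod_topology (weak_topology P \<Psi>) ?V"
  have x: "x t \<in> weighted_C (S t) (\<psi> t)" if "t \<le> T" for t using assms that by auto
  have "continuous_map ?W euclideanreal (pairing (S t) (x t) \<circ> ((\<lambda>\<theta>. \<theta> t) \<circ> snd))" if "t \<le> T" for t
    using that
    by (intro continuous_map_compose[OF _ continuous_map_pairing[OF x]]
        continuous_map_compose[OF continuous_map_snd continuous_map_product_projection]) auto
  moreover have "continuous_map ?W euclideanreal (pairing P (\<lambda>s. - (\<Sum>t\<le>T. x t (s t))) \<circ> fst)"
    by (intro continuous_map_compose[OF continuous_map_fst continuous_map_pairing]
        neg_sum_coordinates(1)[OF x])
  ultimately show ?thesis
    unfolding gap_def case_prod_beta
    by (intro continuous_map_add continuous_map_sum) (auto simp: o_def)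
qed

lemma gap_sum:
  assumes F: "finite F" "F \<subseteq> (\<Pi> t\<in>{..T}. weighted_C (S t) (\<psi> t))"
    and \<nu>: "\<nu> \<in> weighted_M P \<Psi>" and \<theta>: "\<And>t. t \<le> T \<Longrightarrow> \<theta> t \<in> weighted_M (S t) (\<psi> t)"
  shows "gap (\<lambda>t s. \<Sum>x\<in>F. c x *\<^sub>R x t s) (\<nu>, \<theta>) = (\<Sum>x\<in>F. c x * gap x (\<nu>, \<theta>))"
proof -
  have x: "x t \<in> weighted_C (S t) (\<psi> t)" if "x \<in> F" "t \<le> T" for x t using F(2) that by auto
  have xP: "(\<lambda>s. - (\<Sum>t\<le>T. x t (s t))) \<in> weighted_C P \<Psi>" if "x \<in> F" for x
    by (rule neg_sum_coordinates(1)[OF x[OF that]])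
  have "(\<lambda>s. - (\<Sum>t\<le>T. \<Sum>x\<in>F. c x *\<^sub>R x t (s t))) = (\<lambda>s. \<Sum>x\<in>F. c x *\<^sub>R (- (\<Sum>t\<le>T. x t (s t))))"
    by (simp add: sum.swap[of _ F] scaleR_sum_right sum_negf)
  then have "pairing P (\<lambda>s. - (\<Sum>t\<le>T. \<Sum>x\<in>F. c x *\<^sub>R x t (s t))) \<nu>
      = (\<Sum>x\<in>F. c x * pairing P (\<lambda>s. - (\<Sum>t\<le>T. x t (s t))) \<nu>)"
    using pairing_sum[OF sum_weight_ge_1 \<nu> xP, where J = F and a = c] by simp
  moreover have "(\<Sum>t\<le>T. pairing (S t) (\<lambda>s. \<Sum>x\<in>F. c x *\<^sub>R x t s) (\<theta> t))
      = (\<Sum>x\<in>F. c x * (\<Sum>t\<le>T. pairing (S t) (x t) (\<theta> t)))"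
  proof -
    have "(\<Sum>t\<le>T. pairing (S t) (\<lambda>s. \<Sum>x\<in>F. c x *\<^sub>R x t s) (\<theta> t))
        = (\<Sum>t\<le>T. \<Sum>x\<in>F. c x * pairing (S t) (x t) (\<theta> t))"
      by (intro sum.cong refl pairing_sum[OF weight_ge_1 \<theta> x]) auto
    then show ?thesis by (simp add: sum.swap[of _ F] sum_distrib_left)
  qed
  ultimately show ?thesis
    unfolding gap_def by (simp add: sum.distrib distrib_left)
qed

lemma gap_convex:
  assumes x: "x \<in> (\<Pi> t\<in>{..T}. weighted_C (S t) (\<psi> t))"
    and \<nu>: "\<nu> \<in> weighted_M P \<Psi>" "\<nu>' \<in> weighted_M P \<Psi>"
      "(\<lambda>A. a *\<^sub>R \<nu> A + b *\<^sub>R \<nu>' A) \<in> weighted_M P \<Psi>"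
    and \<theta>: "\<And>t. t \<le> T \<Longrightarrow> \<theta> t \<in> weighted_M (S t) (\<psi> t)"
      "\<And>t. t \<le> T \<Longrightarrow> \<theta>' t \<in> weighted_M (S t) (\<psi> t)"
      "\<And>t. t \<le> T \<Longrightarrow> (\<lambda>A. a *\<^sub>R \<theta> t A + b *\<^sub>R \<theta>' t A) \<in> weighted_M (S t) (\<psi> t)"
  shows "gap x (\<lambda>A. a *\<^sub>R \<nu> A + b *\<^sub>R \<nu>' A, \<lambda>t\<in>{..T}. \<lambda>A. a *\<^sub>R \<theta> t A + b *\<^sub>R \<theta>' t A)
      = a * gap x (\<nu>, \<theta>) + b * gap x (\<nu>', \<theta>')"
proof -
  have x': "x t \<in> weighted_C (S t) (\<psi> t)" if "t \<le> T" for t using x that by auto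
  have "(\<Sum>t\<le>T. pairing (S t) (x t) ((\<lambda>t\<in>{..T}. \<lambda>A. a *\<^sub>R \<theta> t A + b *\<^sub>R \<theta>' t A) t))
      = (\<Sum>t\<le>T. a * pairing (S t) (x t) (\<theta> t) + b * pairing (S t) (x t) (\<theta>' t))"
    by (intro sum.cong refl) (auto intro!: pairing_convex[OF weight_ge_1 x' \<theta>])
  then show ?thesis
    unfolding gap_def using pairing_convex[OF sum_weight_ge_1 neg_sum_coordinates(1)[OF x'] \<nu>]
    by (simp add: sum.distrib sum_distrib_left distrib_left)
qed

end

section \<open>Existence of a measure with prescribed marginals\<close>

theorem theorem4:
  fixes S :: "nat \<Rightarrow> 'a topology" and T :: nat
    and \<psi> :: "nat \<Rightarrow> 'a \<Rightarrow> real"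
    and \<Lambda> :: "((nat \<Rightarrow> 'a) set \<Rightarrow> real ^ 'd) set"
    and \<Lambda>t :: "nat \<Rightarrow> ('a set \<Rightarrow> real ^ 'd) set"
  assumes "\<And>t. t \<le> T \<Longrightarrow> polish_topology (S t)"
    and "\<And>t. t \<le> T \<Longrightarrow> continuous_map (S t) euclideanreal (\<psi> t)"
    and "\<And>t s. t \<le> T \<Longrightarrow> s \<in> topspace (S t) \<Longrightarrow> 1 \<le> \<psi> t s"
    and "\<Lambda> \<subseteq> weighted_M (path_space S T) (sum_weight \<psi> T)"
    and "compactin (weak_topology (path_space S T) (sum_weight \<psi> T)) \<Lambda>"
    and "convex_measures \<Lambda>"
    and "\<And>t. t \<le> T \<Longrightarrow> \<Lambda>t t \<subseteq> weighted_M (S t) (\<psi> t)"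
    and "\<And>t. t \<le> T \<Longrightarrow> compactin (weak_topology (S t) (\<psi> t)) (\<Lambda>t t)"
    and "\<And>t. t \<le> T \<Longrightarrow> convex_measures (\<Lambda>t t)"
  shows "(\<exists>\<nu>\<in>\<Lambda>. \<forall>t\<le>T. marginal S T t \<nu> \<in> \<Lambda>t t) \<longleftrightarrow>
    (\<forall>x \<in> (\<Pi> t\<in>{..T}. weighted_C (S t) (\<psi> t)).
       (\<Sum>t\<le>T. support_fun (S t) (\<Lambda>t t) (x t))
         + support_fun (path_space S T) \<Lambda> (\<lambda>s. - (\<Sum>t\<le>T. x t (s t))) \<ge> 0)"
proof -
  interpret marginal_setting S T \<psi>
  proof
    show "metrizable_space (S t)" if "t \<le> T" for t
      using assms(1)[OF that] completely_metrizable_imp_metrizable_space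
      unfolding polish_topology_def by blast
  qed (rule assms(3))
  let ?D = "\<Pi> t\<in>{..T}. (weighted_C (S t) (\<psi> t) :: ('a \<Rightarrow> real ^ 'd) set)"
  let ?\<sigma> = "\<lambda>x. (\<Sum>t\<le>T. support_fun (S t) (\<Lambda>t t) (x t))
         + support_fun P \<Lambda> (\<lambda>s. - (\<Sum>t\<le>T. x t (s t)))"
  have \<Lambda>M: "\<nu> \<in> weighted_M P \<Psi>" if "\<nu> \<in> \<Lambda>" for \<nu> using assms(4) that by blast
  have \<Lambda>tM: "\<theta> \<in> weighted_M (S t) (\<psi> t)" if "\<theta> \<in> \<Lambda>t t" "t \<le> T" for \<theta> t
    using assms(7) that by blast
  have nonneg: "0 \<le> ?\<sigma> x" if \<nu>: "\<nu> \<in> \<Lambda>" "\<forall>t\<le>T. marginal S T t \<nu> \<in> \<Lambda>t t" and x: "x \<in> ?D" for \<nu> x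
  proof -
    have x': "x t \<in> weighted_C (S t) (\<psi> t)" if "t \<le> T" for t using x that by auto
    have "(\<Sum>t\<le>T. pairing (S t) (x t) (marginal S T t \<nu>)) = (\<Sum>t\<le>T. pairing P (\<lambda>s. x t (s t)) \<nu>)"
      by (intro sum.cong refl pairing_marginal[OF _ \<Lambda>M[OF \<nu>(1)] x']) auto
    then have "0 = ereal (\<Sum>t\<le>T. pairing (S t) (x t) (marginal S T t \<nu>))
        + ereal (pairing P (\<lambda>s. - (\<Sum>t\<le>T. x t (s t))) \<nu>)"
      using neg_sum_coordinates(2)[OF x' \<Lambda>M[OF \<nu>(1)]] by (simp add: zero_ereal_def)
    also have "\<dots> = (\<Sum>t\<le>T. ereal (pairing (S t) (x t) (marginal S T t \<nu>)))
        + ereal (pairing P (\<lambda>s. - (\<Sum>t\<le>T. x t (s t))) \<nu>)"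
      by simp
    also have "\<dots> \<le> ?\<sigma> x"
      using \<nu> by (intro add_mono sum_mono support_fun_upper) auto
    finally show ?thesis .
  qed
  have exists: "\<exists>\<nu>\<in>\<Lambda>. \<forall>t\<le>T. marginal S T t \<nu> \<in> \<Lambda>t t" if \<sigma>: "\<And>x. x \<in> ?D \<Longrightarrow> 0 \<le> ?\<sigma> x"
  proof -
    \<comment> \<open>For \<open>x = 0\<close> each support function is 0 or, on an empty set, \<open>-\<infinity>\<close>.\<close>
    have zero: "0 \<le> (\<Sum>t\<le>T. support_fun (S t) (\<Lambda>t t) (\<lambda>s. 0)) + support_fun P \<Lambda> (\<lambda>s. 0)"
      using \<sigma>[of "\<lambda>t s. 0"] by (simp add: zero_weighted_C)
    have le0: "(\<Sum>t\<in>I. support_fun (S t) (\<Lambda>t t) (\<lambda>s. 0)) \<le> 0" for I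
      by (intro sum_nonpos support_fun_zero)
    have ne: "\<Lambda> \<noteq> {}"
    proof
      assume "\<Lambda> = {}"
      then have "support_fun P \<Lambda> (\<lambda>s. 0) = - \<infinity>" by (simp add: support_fun_def bot_ereal_def)
      with zero le0[of "{..T}"] show False
        by (cases "\<Sum>t\<le>T. support_fun (S t) (\<Lambda>t t) (\<lambda>s. 0)") auto
    qed
    have net: "\<Lambda>t t \<noteq> {}" if t: "t \<le> T" for t
    proof
      assume "\<Lambda>t t = {}"
      then have "support_fun (S t) (\<Lambda>t t) (\<lambda>s. 0) = - \<infinity>" by (simp add: support_fun_def bot_ereal_def)
      then have "(\<Sum>t\<le>T. support_fun (S t) (\<Lambda>t t) (\<lambda>s. 0)) = - \<infinity>"
        using t le0[of "{..T} - {t}"] by (subst sum.remove[of _ t]) auto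
      with zero support_fun_zero[of P \<Lambda>] show False
        by (cases "support_fun P \<Lambda> (\<lambda>s. 0)") auto
    qed
    let ?W = "prod_topology (weak_topology P \<Psi>)
        (product_topology (\<lambda>t. weak_topology (S t) (\<psi> t)) {..T})"
    let ?K = "\<Lambda> \<times> PiE {..T} \<Lambda>t"
    have "\<exists>k\<in>?K. \<forall>x\<in>?D. gap x k = 0"
    proof (rule convex_compact_common_zero)
      show "compactin ?W ?K"
        using assms(5,8) by (auto simp: compactin_Times compactin_PiE)
      show "?K \<noteq> {}" using ne net by (auto simp: PiE_eq_empty_iff)
      show "continuous_map ?W euclideanreal (gap x)" if "x \<in> ?D" for x
        by (rule continuous_map_gap[OF that])
    next
      fix k l and a :: real assume "k \<in> ?K" "l \<in> ?K" and a: "0 \<le> a" "a \<le> 1"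
      then obtain \<nu> \<theta> \<nu>' \<theta>' where kl: "k = (\<nu>, \<theta>)" "l = (\<nu>', \<theta>')"
        and \<nu>: "\<nu> \<in> \<Lambda>" "\<nu>' \<in> \<Lambda>"
        and \<theta>: "\<And>t. t \<le> T \<Longrightarrow> \<theta> t \<in> \<Lambda>t t" "\<And>t. t \<le> T \<Longrightarrow> \<theta>' t \<in> \<Lambda>t t"
        by (auto simp: PiE_iff)
      have \<nu>m: "(\<lambda>A. (1 - a) *\<^sub>R \<nu> A + a *\<^sub>R \<nu>' A) \<in> \<Lambda>"
        using assms(6) \<nu> a unfolding convex_measures_def by simp
      have \<theta>m: "(\<lambda>A. (1 - a) *\<^sub>R \<theta> t A + a *\<^sub>R \<theta>' t A) \<in> \<Lambda>t t" if "t \<le> T" for t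
        using assms(9)[OF that] \<theta>[OF that] a unfolding convex_measures_def by simp
      let ?m = "(\<lambda>A. (1 - a) *\<^sub>R \<nu> A + a *\<^sub>R \<nu>' A, \<lambda>t\<in>{..T}. \<lambda>A. (1 - a) *\<^sub>R \<theta> t A + a *\<^sub>R \<theta>' t A)"
      have "?m \<in> ?K" using \<nu>m \<theta>m by auto
      moreover have "gap x ?m = (1 - a) * gap x k + a * gap x l" if "x \<in> ?D" for x
        unfolding kl
        by (rule gap_convex[OF that]) (auto intro: \<Lambda>M \<Lambda>tM \<nu> \<theta> \<nu>m \<theta>m)
      ultimately show "\<exists>m\<in>?K. \<forall>x\<in>?D. gap x m = (1 - a) * gap x k + a * gap x l" by blast
    next
      \<comment> \<open>The hypothesis for the combination \<open>\<Sum>y\<in>F. c y *\<^sub>R y\<close>, evaluated at maximisers of all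
        support functions.\<close>
      fix F and c :: "(nat \<Rightarrow> 'a \<Rightarrow> real ^ 'd) \<Rightarrow> real" assume F: "finite F" "F \<subseteq> ?D"
      define x where "x = (\<lambda>t s. \<Sum>y\<in>F. c y *\<^sub>R y t s)"
      have xt: "x t \<in> weighted_C (S t) (\<psi> t)" if "t \<le> T" for t
        unfolding x_def using F that by (intro weighted_C_sum weight_ge_1) auto
      obtain \<nu> where \<nu>: "\<nu> \<in> \<Lambda>"
        "support_fun P \<Lambda> (\<lambda>s. - (\<Sum>t\<le>T. x t (s t))) = ereal (pairing P (\<lambda>s. - (\<Sum>t\<le>T. x t (s t))) \<nu>)"
        using support_fun_attained[OF assms(5) ne neg_sum_coordinates(1)[OF xt]] by blast
      have "\<exists>\<theta>. \<theta> \<in> \<Lambda>t t \<and> support_fun (S t) (\<Lambda>t t) (x t) = ereal (pairing (S t) (x t) \<theta>)"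
        if "t \<le> T" for t
        using support_fun_attained[OF assms(8)[OF that] net[OF that] xt[OF that]] by metis
      then obtain \<theta> where \<theta>: "\<And>t. t \<le> T \<Longrightarrow> \<theta> t \<in> \<Lambda>t t"
        "\<And>t. t \<le> T \<Longrightarrow> support_fun (S t) (\<Lambda>t t) (x t) = ereal (pairing (S t) (x t) (\<theta> t))"
        by metis
      let ?\<theta> = "restrict \<theta> {..T}"
      have "?\<sigma> x = ereal (gap x (\<nu>, ?\<theta>))"
        unfolding gap_def using \<nu>(2) \<theta>(2) by simp
      moreover have "0 \<le> ?\<sigma> x" by (rule \<sigma>) (use xt in auto)
      ultimately have "0 \<le> gap x (\<nu>, ?\<theta>)" by simp
      also have "gap x (\<nu>, ?\<theta>) = (\<Sum>y\<in>F. c y * gap y (\<nu>, ?\<theta>))"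
        unfolding x_def by (rule gap_sum[OF F \<Lambda>M[OF \<nu>(1)]]) (simp add: \<theta>(1) \<Lambda>tM)
      finally show "\<exists>k\<in>?K. 0 \<le> (\<Sum>y\<in>F. c y * gap y k)"
        using \<nu>(1) \<theta>(1) by (intro bexI[of _ "(\<nu>, ?\<theta>)"]) auto
    qed
    then obtain \<nu> \<theta> where \<nu>: "\<nu> \<in> \<Lambda>" and \<theta>PiE: "\<theta> \<in> PiE {..T} \<Lambda>t"
      and gap0: "\<And>x. x \<in> ?D \<Longrightarrow> gap x (\<nu>, \<theta>) = 0"
      by blast
    have \<theta>: "\<theta> t \<in> \<Lambda>t t" if "t \<le> T" for t
      by (rule PiE_mem[OF \<theta>PiE]) (simp add: that)
    have marg: "marginal S T t \<nu> = \<theta> t" if t: "t \<le> T" for t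
    proof (rule eq_marginalI[OF t \<Lambda>M[OF \<nu>] \<Lambda>tM[OF \<theta>[OF t] t]])
      fix u :: "'a \<Rightarrow> real ^ 'd" assume u: "u \<in> weighted_C (S t) (\<psi> t)"
      \<comment> \<open>The constraint for coordinate \<open>t\<close> alone.\<close>
      define x where "x = (\<lambda>r. if r = t then u else (\<lambda>s. 0))"
      have x: "x r \<in> weighted_C (S r) (\<psi> r)" for r
        using u by (simp add: x_def zero_weighted_C)
      have 1: "pairing (S r) (x r) (\<theta> r) = (if r = t then pairing (S t) u (\<theta> t) else 0)" for r
        by (simp add: x_def pairing_zero)
      have 2: "pairing P (\<lambda>s. x r (s r)) \<nu> = (if r = t then pairing P (\<lambda>s. u (s t)) \<nu> else 0)" for r
        by (simp add: x_def pairing_zero)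
      have "gap x (\<nu>, \<theta>) = pairing (S t) u (\<theta> t) - pairing P (\<lambda>s. u (s t)) \<nu>"
        unfolding gap_def using t neg_sum_coordinates(2)[OF x \<Lambda>M[OF \<nu>]] by (simp add: 1 2)
      moreover have "gap x (\<nu>, \<theta>) = 0" by (rule gap0) (use x in auto)
      ultimately show "pairing (S t) u (\<theta> t) = pairing P (\<lambda>s. u (s t)) \<nu>" by simp
    qed
    show ?thesis
    proof (intro bexI[OF _ \<nu>] allI impI)
      fix t assume t: "t \<le> T"
      show "marginal S T t \<nu> \<in> \<Lambda>t t" unfolding marg[OF t] by (rule \<theta>[OF t])
    qed
  qed
  show ?thesis
  proof (intro iffI ballI)
    fix x assume "\<exists>\<nu>\<in>\<Lambda>. \<forall>t\<le>T. marginal S T t \<nu> \<in> \<Lambda>t t" and x: "x \<in> ?D"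
    then obtain \<nu> where "\<nu> \<in> \<Lambda>" "\<forall>t\<le>T. marginal S T t \<nu> \<in> \<Lambda>t t" by blast
    then show "0 \<le> ?\<sigma> x" using x by (rule nonneg)
  next
    assume all: "\<forall>x\<in>?D. 0 \<le> ?\<sigma> x"
    show "\<exists>\<nu>\<in>\<Lambda>. \<forall>t\<le>T. marginal S T t \<nu> \<in> \<Lambda>t t" by (rule exists[OF bspec[OF all]])
  qed
qed

end
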